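(* Let $k$ be a field of characteristic $0$, let $n\ge 1$, $S=k[x_1,\dots,x_n]$ and $E=k[X_1,\dots,X_n]$, where $x_i$ acts on $E$ as $\partial/\partial X_i$. For each integer $e\ge 0$ let $h_e=\sum_{i_1+\cdots+i_n=e}X_1^{i_1}\cdots X_n^{i_n}\in E$ be the complete symmetric polynomial of degree $e$. Then the Gorenstein algebra $A=S/\operatorname{ann}(h_e)$ is compressed and satisfies the Strong Lefschetz Property.
   Context: For $f\in E$, $\operatorname{ann}(f)=\{g\in S: g\circ f=0\}$, where $\circ$ denotes the action of $S$ on $E$ by differentiation. For a nonzero form $f$ of degree $e$, $S/\operatorname{ann}(f)$ is a graded artinian Gorenstein algebra of socle degree $e$. It is compressed if $\dim_k [S/\operatorname{ann}(f)]_i=\min(\dim_k S_i,\dim_k S_{e-i})$ for all $0\le i\le e$. A graded artinian $k$-algebra $A$ (a quotient of $S$) satisfies the Strong Lefschetz Property (SLP) if, for a general linear form $\ell$, the multiplication map $\times \ell^j:[A]_i\to[A]_{i+j}$ has maximal rank (is injective or surjective) for all $i\ge0$ and $j\ge 0$. *)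

theory Defs
  imports
    "HOL-Library.Poly_Mapping"
    "HOL-Algebra.Embedded_Algebras"
    "HOL-Algebra.QuotRing"
    "HOL-Algebra.Algebraic_Closure_Type"
begin

text \<open>
  Polynomials over \<open>'k\<close> in variables indexed by the finite type \<open>'n\<close>: finitely supported maps from
  exponent vectors to coefficients. This one type serves both as \<open>S\<close> (the differential operators)
  and as \<open>E\<close> (the polynomials operated upon).
\<close>

type_synonym ('n, 'k) mpoly = "('n \<Rightarrow>\<^sub>0 nat) \<Rightarrow>\<^sub>0 'k"

definition Const :: "'k::zero \<Rightarrow> ('n, 'k) mpoly" where
  "Const c = Poly_Mapping.single 0 c"

definition Var :: "'n \<Rightarrow> ('n, 'k::zero_neq_one) mpoly" where
  "Var v = Poly_Mapping.single (Poly_Mapping.single v 1) 1"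

definition mdeg :: "('n::finite \<Rightarrow>\<^sub>0 nat) \<Rightarrow> nat" where
  "mdeg \<alpha> = (\<Sum>v\<in>UNIV. Poly_Mapping.lookup \<alpha> v)"

definition forms :: "nat \<Rightarrow> ('n::finite, 'k::zero) mpoly set" where
  "forms d = {f. \<forall>\<alpha>\<in>Poly_Mapping.keys f. mdeg \<alpha> = d}"

definition eval_mpoly :: "('n::finite \<Rightarrow> 'k::comm_semiring_1) \<Rightarrow> ('n, 'k) mpoly \<Rightarrow> 'k" where
  "eval_mpoly a f =
     (\<Sum>\<alpha>\<in>Poly_Mapping.keys f.
        Poly_Mapping.lookup f \<alpha> * (\<Prod>v\<in>UNIV. a v ^ Poly_Mapping.lookup \<alpha> v))"

definition complete_symmetric :: "nat \<Rightarrow> ('n::finite, 'k::comm_semiring_1) mpoly" where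
  "complete_symmetric e = (\<Sum>\<alpha> | mdeg \<alpha> = e. Poly_Mapping.single \<alpha> 1)"

lemma finite_mdeg: "finite {\<alpha> :: 'n::finite \<Rightarrow>\<^sub>0 nat. mdeg \<alpha> = d}"
proof -
  have "Poly_Mapping.lookup ` {\<alpha> :: 'n \<Rightarrow>\<^sub>0 nat. mdeg \<alpha> = d} \<subseteq> (UNIV :: 'n set) \<rightarrow>\<^sub>E {..d}"
    by (auto simp: mdeg_def intro: member_le_sum)
  moreover have "finite ((UNIV :: 'n set) \<rightarrow>\<^sub>E {..d})"
    by (intro finite_PiE) auto
  ultimately have "finite (Poly_Mapping.lookup ` {\<alpha> :: 'n \<Rightarrow>\<^sub>0 nat. mdeg \<alpha> = d})"
    by (rule finite_subset)
  then show ?thesis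
    by (rule finite_imageD) (auto simp: inj_on_def poly_mapping.lookup_inject)
qed

lemma lookup_complete_symmetric:
  "Poly_Mapping.lookup (complete_symmetric e) \<alpha> = (if mdeg \<alpha> = e then 1 else 0)"
  by (simp add: complete_symmetric_def lookup_sum lookup_single finite_mdeg when_def)

definition partial_deriv :: "'n \<Rightarrow> ('n, 'k::comm_semiring_1) mpoly \<Rightarrow> ('n, 'k) mpoly" where
  "partial_deriv v f =
     (\<Sum>\<beta>\<in>Poly_Mapping.keys f.
        Poly_Mapping.single (\<beta> - Poly_Mapping.single v 1)
          (of_nat (Poly_Mapping.lookup \<beta> v) * Poly_Mapping.lookup f \<beta>))"

lemma lookup_partial_deriv:
  "Poly_Mapping.lookup (partial_deriv v f) \<gamma> =
     of_nat (Suc (Poly_Mapping.lookup \<gamma> v)) * Poly_Mapping.lookup f (\<gamma> + Poly_Mapping.single v 1)"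
proof -
  let ?e = "Poly_Mapping.single v (1::nat)"
  let ?t = "\<lambda>\<beta>. Poly_Mapping.lookup (Poly_Mapping.single (\<beta> - ?e)
          (of_nat (Poly_Mapping.lookup \<beta> v) * Poly_Mapping.lookup f \<beta>)) \<gamma>"
  have z: "?t \<beta> = 0" if "\<beta> \<noteq> \<gamma> + ?e" for \<beta>
  proof (cases "Poly_Mapping.lookup \<beta> v = 0")
    case False
    have "\<beta> = (\<beta> - ?e) + ?e"
      using False by (intro poly_mapping_eqI) (auto simp: lookup_add lookup_minus lookup_single when_def)
    with that have "\<beta> - ?e \<noteq> \<gamma>" by metis
    then show ?thesis by (simp add: lookup_single when_def)
  qed simp
  have "Poly_Mapping.lookup (partial_deriv v f) \<gamma> = (\<Sum>\<beta>\<in>Poly_Mapping.keys f. ?t \<beta>)"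
    by (simp add: partial_deriv_def lookup_sum)
  also have "\<dots> = (\<Sum>\<beta>\<in>Poly_Mapping.keys f. if \<beta> = \<gamma> + ?e then ?t \<beta> else 0)"
    by (intro sum.cong refl) (use z in auto)
  also have "\<dots> = (if \<gamma> + ?e \<in> Poly_Mapping.keys f then ?t (\<gamma> + ?e) else 0)"
    by simp
  also have "\<dots> = of_nat (Suc (Poly_Mapping.lookup \<gamma> v)) * Poly_Mapping.lookup f (\<gamma> + ?e)"
    by (auto simp: lookup_add lookup_single in_keys_iff)
  finally show ?thesis .
qed

lemma partial_deriv_commute: "partial_deriv u \<circ> partial_deriv v = partial_deriv v \<circ> partial_deriv u"
  by (intro ext poly_mapping_eqI)
     (auto simp: lookup_partial_deriv lookup_add lookup_single when_def add_ac mult_ac)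

interpretation partial_deriv: comp_fun_commute partial_deriv
  by standard (rule partial_deriv_commute)

lemma lookup_partial_deriv_funpow:
  "Poly_Mapping.lookup ((partial_deriv v ^^ n) f) \<gamma> =
     of_nat (pochhammer (Suc (Poly_Mapping.lookup \<gamma> v)) n) *
     Poly_Mapping.lookup f (\<gamma> + Poly_Mapping.single v n)"
proof (induction n arbitrary: \<gamma>)
  case (Suc n)
  have "\<gamma> + Poly_Mapping.single v 1 + Poly_Mapping.single v n = \<gamma> + Poly_Mapping.single v (Suc n)"
    by (simp add: add.assoc single_add [symmetric])
  then show ?case
    by (simp add: Suc.IH lookup_partial_deriv lookup_add pochhammer_rec algebra_simps)
qed simp

definition monom_deriv ::
  "('n::finite \<Rightarrow>\<^sub>0 nat) \<Rightarrow> ('n, 'k::comm_semiring_1) mpoly \<Rightarrow> ('n, 'k) mpoly" where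
  "monom_deriv \<alpha> f =
     Finite_Set.fold (\<lambda>v. partial_deriv v ^^ Poly_Mapping.lookup \<alpha> v) f UNIV"

lemma lookup_monom_deriv:
  fixes f :: "('n::finite, 'k::comm_semiring_1) mpoly"
  shows "Poly_Mapping.lookup (monom_deriv \<alpha> f) \<gamma> =
     of_nat (\<Prod>v\<in>UNIV. pochhammer (Suc (Poly_Mapping.lookup \<gamma> v)) (Poly_Mapping.lookup \<alpha> v)) *
     Poly_Mapping.lookup f (\<gamma> + \<alpha>)"
proof -
  let ?F = "\<lambda>v. (partial_deriv v :: ('n, 'k) mpoly \<Rightarrow> _) ^^ Poly_Mapping.lookup \<alpha> v"
  interpret F: comp_fun_commute ?F
    by (rule partial_deriv.comp_fun_commute_funpow)
  have "Poly_Mapping.lookup (Finite_Set.fold ?F f A) \<gamma> =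
      of_nat (\<Prod>v\<in>A. pochhammer (Suc (Poly_Mapping.lookup \<gamma> v)) (Poly_Mapping.lookup \<alpha> v)) *
      Poly_Mapping.lookup f (\<gamma> + (\<Sum>v\<in>A. Poly_Mapping.single v (Poly_Mapping.lookup \<alpha> v)))"
    if "finite A" for A
    using that
  proof (induction A arbitrary: \<gamma>)
    case (insert u A)
    have "(\<Prod>v\<in>A. pochhammer (Suc (Poly_Mapping.lookup
              (\<gamma> + Poly_Mapping.single u (Poly_Mapping.lookup \<alpha> u)) v)) (Poly_Mapping.lookup \<alpha> v)) =
          (\<Prod>v\<in>A. pochhammer (Suc (Poly_Mapping.lookup \<gamma> v)) (Poly_Mapping.lookup \<alpha> v))"
      using insert.hyps by (intro prod.cong) (auto simp: lookup_add lookup_single when_def)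
    then show ?case
      using insert.hyps
      by (simp add: lookup_partial_deriv_funpow insert.IH mult.assoc add.assoc)
  qed simp
  from this [of UNIV]
  have "Poly_Mapping.lookup (monom_deriv \<alpha> f) \<gamma> =
      of_nat (\<Prod>v\<in>UNIV. pochhammer (Suc (Poly_Mapping.lookup \<gamma> v)) (Poly_Mapping.lookup \<alpha> v)) *
      Poly_Mapping.lookup f (\<gamma> + (\<Sum>v\<in>UNIV. Poly_Mapping.single v (Poly_Mapping.lookup \<alpha> v)))"
    by (simp add: monom_deriv_def)
  also have "(\<Sum>v\<in>UNIV. Poly_Mapping.single v (Poly_Mapping.lookup \<alpha> v)) = \<alpha>"
    by (intro poly_mapping_eqI) (simp add: lookup_sum lookup_single when_def)
  finally show ?thesis .
qed

definition diff_act ::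
  "('n::finite, 'k::comm_semiring_1) mpoly \<Rightarrow> ('n, 'k) mpoly \<Rightarrow> ('n, 'k) mpoly"
  (infixr \<open>\<circ>\<^sub>D\<close> 75) where
  "g \<circ>\<^sub>D f =
     (\<Sum>\<alpha>\<in>Poly_Mapping.keys g. Const (Poly_Mapping.lookup g \<alpha>) * monom_deriv \<alpha> f)"

lemma lookup_Const_mult:
  "Poly_Mapping.lookup (Const c * f) \<gamma> = c * Poly_Mapping.lookup f \<gamma>"
  by (simp add: Const_def lookup_mult lookup_single when_mult)

lemma diff_act_single:
  "Poly_Mapping.single \<alpha> c \<circ>\<^sub>D f = Const c * monom_deriv \<alpha> f"
  by (cases "c = 0") (auto simp: diff_act_def Const_def)

lemma diff_act_add_left: "(g + h) \<circ>\<^sub>D f = g \<circ>\<^sub>D f + h \<circ>\<^sub>D f"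
  unfolding diff_act_def
  by (rule setsum_keys_plus_distrib) (simp_all add: Const_def single_add distrib_right)

lemma monom_deriv_add: "monom_deriv \<alpha> (f + g) = monom_deriv \<alpha> f + monom_deriv \<alpha> g"
  by (intro poly_mapping_eqI) (simp add: lookup_monom_deriv lookup_add distrib_left)

lemma diff_act_add_right: "g \<circ>\<^sub>D (f + h) = g \<circ>\<^sub>D f + g \<circ>\<^sub>D h"
  by (simp add: diff_act_def monom_deriv_add distrib_left sum.distrib)

lemma diff_act_zero_right: "(g :: ('n::finite, 'k::comm_semiring_1) mpoly) \<circ>\<^sub>D 0 = 0"
proof -
  have "monom_deriv \<alpha> (0 :: ('n, 'k) mpoly) = 0" for \<alpha>
    by (intro poly_mapping_eqI) (simp add: lookup_monom_deriv)
  then show ?thesis by (simp add: diff_act_def)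
qed

lemma diff_act_Const: "Const c \<circ>\<^sub>D f = Const c * f"
proof -
  have "monom_deriv 0 f = f"
    by (intro poly_mapping_eqI) (simp add: lookup_monom_deriv)
  then show ?thesis
    using diff_act_single [of 0 c f] by (simp add: Const_def)
qed

lemma diff_act_Var: "Var v \<circ>\<^sub>D f = partial_deriv v f"
proof -
  have "(\<Prod>u\<in>UNIV. pochhammer (Suc (Poly_Mapping.lookup \<gamma> u))
          (Poly_Mapping.lookup (Poly_Mapping.single v 1) u)) = Suc (Poly_Mapping.lookup \<gamma> v)" for \<gamma>
  proof -
    have "(\<Prod>u\<in>UNIV. pochhammer (Suc (Poly_Mapping.lookup \<gamma> u))
            (Poly_Mapping.lookup (Poly_Mapping.single v 1) u)) =
          (\<Prod>u\<in>UNIV. if u = v then Suc (Poly_Mapping.lookup \<gamma> u) else 1)"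
      by (intro prod.cong) (auto simp: lookup_single when_def)
    then show ?thesis by simp
  qed
  then show ?thesis
    unfolding Var_def diff_act_single
    by (intro poly_mapping_eqI)
       (simp add: lookup_Const_mult lookup_monom_deriv lookup_partial_deriv del: of_nat_Suc)
qed

lemma monom_deriv_monom_deriv: "monom_deriv \<alpha> (monom_deriv \<beta> f) = monom_deriv (\<alpha> + \<beta>) f"
  by (intro poly_mapping_eqI)
     (simp add: lookup_monom_deriv lookup_add pochhammer_product' prod.distrib mult_ac add_ac)

lemma monom_deriv_Const_mult: "monom_deriv \<alpha> (Const c * f) = Const c * monom_deriv \<alpha> f"
  by (intro poly_mapping_eqI) (simp add: lookup_monom_deriv lookup_Const_mult mult.left_commute [of c])

lemma sum_singles: "(\<Sum>\<alpha>\<in>Poly_Mapping.keys g. Poly_Mapping.single \<alpha> (Poly_Mapping.lookup g \<alpha>)) = g"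
  by (intro poly_mapping_eqI) (auto simp: lookup_sum lookup_single when_def in_keys_iff)

lemma diff_act_sum_left: "(\<Sum>x\<in>A. g x) \<circ>\<^sub>D f = (\<Sum>x\<in>A. g x \<circ>\<^sub>D f)"
proof (induction A rule: infinite_finite_induct)
  case (insert x A)
  then show ?case by (simp add: diff_act_add_left)
qed (simp_all add: diff_act_def)

lemma diff_act_sum_right: "g \<circ>\<^sub>D (\<Sum>x\<in>A. f x) = (\<Sum>x\<in>A. g \<circ>\<^sub>D f x)"
proof (induction A rule: infinite_finite_induct)
  case (insert x A)
  then show ?case by (simp add: diff_act_add_right)
qed (simp_all add: diff_act_zero_right)

lemma diff_act_mult: "(g * h) \<circ>\<^sub>D f = g \<circ>\<^sub>D h \<circ>\<^sub>D f"
proof -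
  have single: "(Poly_Mapping.single \<alpha> c * Poly_Mapping.single \<beta> d) \<circ>\<^sub>D f =
      Poly_Mapping.single \<alpha> c \<circ>\<^sub>D Poly_Mapping.single \<beta> d \<circ>\<^sub>D f" for \<alpha> \<beta> c d
    by (intro poly_mapping_eqI)
       (simp add: mult_single diff_act_single monom_deriv_Const_mult monom_deriv_monom_deriv
         lookup_Const_mult mult.assoc)
  let ?m = "\<lambda>g \<alpha>. Poly_Mapping.single \<alpha> (Poly_Mapping.lookup g \<alpha>)"
  have "(g * h) \<circ>\<^sub>D f =
      ((\<Sum>\<alpha>\<in>Poly_Mapping.keys g. ?m g \<alpha>) * (\<Sum>\<beta>\<in>Poly_Mapping.keys h. ?m h \<beta>)) \<circ>\<^sub>D f"
    by (simp add: sum_singles)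
  also have "\<dots> = (\<Sum>\<alpha>\<in>Poly_Mapping.keys g. \<Sum>\<beta>\<in>Poly_Mapping.keys h. ?m g \<alpha> \<circ>\<^sub>D ?m h \<beta> \<circ>\<^sub>D f)"
    by (simp add: sum_product diff_act_sum_left single)
  also have "\<dots> = (\<Sum>\<alpha>\<in>Poly_Mapping.keys g. ?m g \<alpha>) \<circ>\<^sub>D (\<Sum>\<beta>\<in>Poly_Mapping.keys h. ?m h \<beta>) \<circ>\<^sub>D f"
    by (simp add: diff_act_sum_left diff_act_sum_right) (rule sum.swap)
  finally show ?thesis by (simp add: sum_singles)
qed

definition ann :: "('n::finite, 'k::comm_semiring_1) mpoly \<Rightarrow> ('n, 'k) mpoly set" where
  "ann f = {g. g \<circ>\<^sub>D f = 0}"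


abbreviation mpoly_ring :: "('n::finite, 'k::comm_ring_1) mpoly ring" where
  "mpoly_ring \<equiv> ring_of_type_algebra"

lemma ideal_ann: "ideal (ann f) (mpoly_ring :: ('n::finite, 'k::comm_ring_1) mpoly ring)"
proof -
  interpret R: cring "mpoly_ring :: ('n, 'k) mpoly ring"
    by (rule cring_from_type_algebra)
  have carr [simp]: "carrier (mpoly_ring :: ('n, 'k) mpoly ring) = UNIV"
    and plus [simp]: "x \<oplus>\<^bsub>mpoly_ring\<^esub> y = x + y"
    and times [simp]: "x \<otimes>\<^bsub>mpoly_ring\<^esub> y = x * y"
    and zero [simp]: "\<zero>\<^bsub>mpoly_ring\<^esub> = (0 :: ('n, 'k) mpoly)" for x y :: "('n, 'k) mpoly"
    by (simp_all add: ring_of_type_algebra_def)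
  have uminus: "\<ominus>\<^bsub>mpoly_ring\<^esub> x = - x" for x :: "('n, 'k) mpoly"
    using R.minus_equality [of "- x" x] by simp
  have ann_times: "g * h \<in> ann f" if "h \<in> ann f" for g h
    using that by (simp add: ann_def diff_act_mult diff_act_zero_right)
  show ?thesis
  proof (rule idealI)
    show "subgroup (ann f) (add_monoid mpoly_ring)"
    proof (rule R.add.subgroupI)
      have "0 \<in> ann f" by (simp add: ann_def diff_act_def)
      then show "ann f \<noteq> {}" by blast
      show "\<ominus>\<^bsub>mpoly_ring\<^esub> x \<in> ann f" if "x \<in> ann f" for x
        using ann_times [OF that, of "- 1"] by (simp add: uminus)
    qed (auto simp: ann_def diff_act_add_left)
  qed (use ann_times in \<open>auto simp: mult.commute R.ring_axioms\<close>)
qed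

abbreviation quot_class ::
  "('n::finite, 'k::comm_ring_1) mpoly set \<Rightarrow> ('n, 'k) mpoly \<Rightarrow> ('n, 'k) mpoly set" where
  "quot_class I g \<equiv> I +>\<^bsub>mpoly_ring\<^esub> g"

definition quot_comp ::
  "('n::finite, 'k::comm_ring_1) mpoly set \<Rightarrow> nat \<Rightarrow> ('n, 'k) mpoly set set" where
  "quot_comp I d = quot_class I ` forms d"

text \<open>
  In both dimensions the base field is embedded as the constants; \<^const>\<open>ring.dim\<close> is a definite
  description, and it is meaningful because \<open>forms d\<close> is spanned by finitely many monomials.
\<close>

definition dim_forms :: "'n::finite itself \<Rightarrow> 'k::field itself \<Rightarrow> nat \<Rightarrow> nat" where
  "dim_forms _ _ d =
     (ring.dim (mpoly_ring :: ('n, 'k) mpoly ring) over range Const) (forms d)"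

definition dim_quot_comp :: "('n::finite, 'k::field) mpoly set \<Rightarrow> nat \<Rightarrow> nat" where
  "dim_quot_comp I d =
     (ring.dim (mpoly_ring Quot I) over (quot_class I ` range Const)) (quot_comp I d)"

text \<open>Used for an ideal \<open>I\<close> of the form \<open>ann f\<close> with \<open>f\<close> a nonzero form of degree \<open>e\<close>.\<close>

definition compressed :: "nat \<Rightarrow> ('n::finite, 'k::field) mpoly set \<Rightarrow> bool" where
  "compressed e I \<longleftrightarrow>
     (\<forall>i\<le>e. dim_quot_comp I i =
        min (dim_forms TYPE('n) TYPE('k) i) (dim_forms TYPE('n) TYPE('k) (e - i)))"


definition zariski_open :: "('n::finite \<Rightarrow> 'k::field) set \<Rightarrow> bool" where
  "zariski_open U \<longleftrightarrow> (\<exists>F. U = {a. \<exists>g\<in>F. eval_mpoly a g \<noteq> 0})"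

definition linear_form :: "('n::finite \<Rightarrow> 'k::comm_semiring_1) \<Rightarrow> ('n, 'k) mpoly" where
  "linear_form a = (\<Sum>v\<in>UNIV. Const (a v) * Var v)"

definition mult_map ::
  "('n::finite, 'k::comm_ring_1) mpoly set \<Rightarrow> ('n, 'k) mpoly \<Rightarrow> nat
    \<Rightarrow> ('n, 'k) mpoly set \<Rightarrow> ('n, 'k) mpoly set" where
  "mult_map I l j x =
     (quot_class I l [^]\<^bsub>mpoly_ring Quot I\<^esub> j) \<otimes>\<^bsub>mpoly_ring Quot I\<^esub> x"

text \<open>
  ``General'' linear form: coefficient vector in some nonempty Zariski-open subset of affine space.
\<close>

definition strong_lefschetz :: "('n::finite, 'k::field) mpoly set \<Rightarrow> bool" where
  "strong_lefschetz I \<longleftrightarrow>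
     (\<exists>U. zariski_open U \<and> U \<noteq> {} \<and>
        (\<forall>a\<in>U. \<forall>i j.
           inj_on (mult_map I (linear_form a) j) (quot_comp I i) \<or>
           mult_map I (linear_form a) j ` quot_comp I i = quot_comp I (i + j)))"

end

theory Submission
  imports Defs "Jordan_Normal_Form.Determinant"
begin

text \<open>
  Let \<open>\<phi>\<close> be the linear functional \<open>x\<^sup>\<alpha> \<mapsto> \<alpha>!\<close>. A form \<open>g\<close> of degree \<open>i \<le> e\<close> annihilates \<open>h\<^sub>e\<close> iff
  \<open>\<phi>(g h) = 0\<close> for all forms \<open>h\<close> of degree \<open>e - i\<close>. Compressedness and the strong Lefschetz
  property both follow once the bilinear form \<open>(g, h) \<mapsto> \<phi>(\<ell>\<^sup>e\<^sup>-\<^sup>2\<^sup>i g h)\<close> on forms of degree \<open>i\<close> is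
  nondegenerate for all \<open>i \<le> e/2\<close>. This is a Zariski-open condition on \<open>\<ell>\<close> (nonvanishing of
  determinants), so one good \<open>\<ell>\<close> suffices. For \<open>\<ell> = x\<^sub>1 + \<dots> + x\<^sub>n\<close> we have
  \<open>\<phi>(\<ell> f) = (deg f + n) \<phi>(f)\<close>, which reduces the claim to the integer matrix \<open>((\<alpha> + \<beta>)!)\<close>. By
  Vandermonde's identity \<open>(\<alpha> + \<beta>)! = \<alpha>! \<beta>! \<Sum>\<^sub>\<sigma> (\<alpha> choose \<sigma>) (\<beta> choose \<sigma>)\<close>, so this matrix is
  positive definite, its determinant is a nonzero integer, and it stays nonzero in characteristic 0.
\<close>

section \<open>The factorial functional\<close>

definition mfact :: "('n::finite \<Rightarrow>\<^sub>0 nat) \<Rightarrow> nat" where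
  "mfact \<alpha> = (\<Prod>v\<in>UNIV. fact (Poly_Mapping.lookup \<alpha> v))"

text \<open>For real coefficients this is integration against exp(-(x_1 + ... + x_n)) over the
  positive orthant. That picture predicts the definiteness of the pairing of forms of equal degree,
  which is proved below by algebra over the integers.\<close>

definition fact_functional :: "('n::finite, 'k::comm_semiring_1) mpoly \<Rightarrow> 'k" where
  "fact_functional f =
     (\<Sum>\<alpha>\<in>Poly_Mapping.keys f. Poly_Mapping.lookup f \<alpha> * of_nat (mfact \<alpha>))"

lemma mfact_pos: "mfact \<alpha> > 0"
  by (simp add: mfact_def)

lemma mdeg_add: "mdeg (\<alpha> + \<beta>) = mdeg \<alpha> + mdeg \<beta>"
  by (simp add: mdeg_def lookup_add sum.distrib)

lemma mdeg_single [simp]: "mdeg (Poly_Mapping.single v n) = n"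
  by (simp add: mdeg_def lookup_single when_def)

lemma mfact_add_single:
  "mfact (\<alpha> + Poly_Mapping.single v 1) = Suc (Poly_Mapping.lookup \<alpha> v) * mfact \<alpha>"
proof -
  have "mfact (\<alpha> + Poly_Mapping.single v 1) =
      (\<Prod>u\<in>UNIV. (if u = v then Suc (Poly_Mapping.lookup \<alpha> u) else 1) * fact (Poly_Mapping.lookup \<alpha> u))"
    unfolding mfact_def by (intro prod.cong) (auto simp: lookup_add lookup_single when_def)
  then show ?thesis
    by (simp add: mfact_def prod.distrib)
qed

text \<open>In each variable a! (a+1)...(a+b) = (a+b)!. The product of Pochhammer symbols is the
  coefficient created by \<open>monom_deriv\<close>, so this is where factorials enter the action on
  \<open>complete_symmetric\<close>.\<close>

lemma mfact_mult_pochhammer: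
  "mfact \<gamma> * (\<Prod>v\<in>UNIV. pochhammer (Suc (Poly_Mapping.lookup \<gamma> v)) (Poly_Mapping.lookup \<alpha> v)) =
     mfact (\<gamma> + \<alpha>)"
proof -
  have "fact a * pochhammer (Suc a) b = (fact (a + b) :: nat)" for a b :: nat
    using pochhammer_product'[of "1::nat" a b] by (simp add: pochhammer_fact)
  then show ?thesis
    by (simp add: mfact_def prod.distrib [symmetric] lookup_add)
qed

lemma fact_functional_add: "fact_functional (f + g) = fact_functional f + fact_functional g"
  unfolding fact_functional_def by (rule setsum_keys_plus_distrib) (simp_all add: distrib_right)

lemma fact_functional_zero [simp]: "fact_functional 0 = 0"
  by (simp add: fact_functional_def)

lemma fact_functional_sum: "fact_functional (\<Sum>x\<in>A. f x) = (\<Sum>x\<in>A. fact_functional (f x))"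
  by (induction A rule: infinite_finite_induct) (auto simp: fact_functional_add)

lemma fact_functional_single: "fact_functional (Poly_Mapping.single \<alpha> c) = c * of_nat (mfact \<alpha>)"
  by (cases "c = 0") (auto simp: fact_functional_def)

lemma Const_mult_single: "Const c * Poly_Mapping.single \<alpha> d = Poly_Mapping.single \<alpha> (c * d)"
  by (simp add: Const_def mult_single)

lemma fact_functional_Const_mult:
  "fact_functional (Const c * f) = c * fact_functional f"
proof -
  have "fact_functional (Const c * f) = fact_functional (\<Sum>\<alpha>\<in>Poly_Mapping.keys f.
      Poly_Mapping.single \<alpha> (c * Poly_Mapping.lookup f \<alpha>))"
    by (subst sum_singles [symmetric, of f]) (simp add: sum_distrib_left Const_mult_single)
  also have "\<dots> = c * fact_functional f"
    by (simp add: fact_functional_sum fact_functional_single fact_functional_def [of f]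
        sum_distrib_left mult.assoc)
  finally show ?thesis .
qed

text \<open>The sum runs over all exponents of degree \<open>d\<close>, not over the keys of
  \<open>f\<close>, so that all forms of degree \<open>d\<close> share one finite index set for
  coordinates and matrices.\<close>

lemma form_expand:
  fixes f :: "('n::finite, 'k::comm_semiring_1) mpoly"
  assumes "f \<in> forms d"
  shows "f = (\<Sum>\<alpha>\<in>{\<alpha>. mdeg \<alpha> = d}. Const (Poly_Mapping.lookup f \<alpha>) * Poly_Mapping.single \<alpha> 1)"
proof (rule poly_mapping_eqI)
  fix \<beta>
  have "Poly_Mapping.lookup f \<beta> = 0" if "mdeg \<beta> \<noteq> d"
    using assms that by (auto simp: forms_def in_keys_iff)
  then show "Poly_Mapping.lookup f \<beta> = Poly_Mapping.lookup
      (\<Sum>\<alpha>\<in>{\<alpha>. mdeg \<alpha> = d}. Const (Poly_Mapping.lookup f \<alpha>) * Poly_Mapping.single \<alpha> 1) \<beta>"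
    by (auto simp: Const_mult_single lookup_sum lookup_single when_def finite_mdeg)
qed

lemma forms_zero [simp]: "0 \<in> forms d"
  by (simp add: forms_def)

lemma forms_add: "f \<in> forms d \<Longrightarrow> g \<in> forms d \<Longrightarrow> f + g \<in> forms d"
  using Poly_Mapping.keys_add [of f g] by (auto simp: forms_def)

lemma forms_uminus: "f \<in> forms d \<Longrightarrow> - f \<in> forms (d :: nat)"
  for f :: "('n::finite, 'k::ab_group_add) mpoly"
  by (simp add: forms_def)

lemma forms_diff: "f \<in> forms d \<Longrightarrow> g \<in> forms d \<Longrightarrow> f - g \<in> forms d"
  for f :: "('n::finite, 'k::ab_group_add) mpoly"
  using forms_add [of f d "- g"] by (simp add: forms_uminus)

lemma forms_sum: "(\<And>x. x \<in> A \<Longrightarrow> f x \<in> forms d) \<Longrightarrow> (\<Sum>x\<in>A. f x) \<in> forms d"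
  by (induction A rule: infinite_finite_induct) (auto intro: forms_add)

lemma forms_single [simp]: "mdeg \<alpha> = d \<Longrightarrow> Poly_Mapping.single \<alpha> c \<in> forms d"
  by (auto simp: forms_def)

lemma forms_mult: "f \<in> forms c \<Longrightarrow> g \<in> forms d \<Longrightarrow> f * g \<in> forms (c + d)"
  using Poly_Mapping.keys_mult [of f g] by (force simp: forms_def mdeg_add)

lemma forms_Const_mult: "f \<in> forms d \<Longrightarrow> Const c * f \<in> forms d"
  using forms_mult [of "Const c" 0 f d] by (simp add: Const_def mdeg_def)

lemma linear_form_in_forms: "linear_form a \<in> forms 1"
  unfolding linear_form_def by (intro forms_sum forms_Const_mult) (simp add: Var_def)

lemma linear_form_power_mult_in_forms: "f \<in> forms d \<Longrightarrow> linear_form a ^ m * f \<in> forms (m + d)"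
proof (induction m)
  case (Suc m)
  then show ?case
    using forms_mult [OF linear_form_in_forms, of "linear_form a ^ m * f" "m + d" a]
    by (simp add: mult.assoc)
qed simp

section \<open>Annihilation of the complete symmetric polynomial in terms of \<phi>\<close>

lemma lookup_diff_act:
  "Poly_Mapping.lookup (g \<circ>\<^sub>D f) \<gamma> =
     (\<Sum>\<alpha>\<in>Poly_Mapping.keys g. Poly_Mapping.lookup g \<alpha> * Poly_Mapping.lookup (monom_deriv \<alpha> f) \<gamma>)"
  by (simp add: diff_act_def lookup_sum lookup_Const_mult)

text \<open>All coefficients of \<open>complete_symmetric e\<close> in degree \<open>e\<close> are
  1, so \<open>monom_deriv \<alpha>\<close> leaves (\<gamma> + \<alpha>)!/\<gamma>! at \<gamma>. The
  factor \<gamma>! on the left clears this denominator.\<close>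

lemma lookup_diff_act_complete_symmetric:
  fixes g :: "('n::finite, 'k::comm_semiring_1) mpoly"
  assumes "g \<in> forms i"
  shows "of_nat (mfact \<gamma>) * Poly_Mapping.lookup (g \<circ>\<^sub>D complete_symmetric e) \<gamma> =
     (if mdeg \<gamma> + i = e then fact_functional (g * Poly_Mapping.single \<gamma> 1) else 0)"
proof -
  have "of_nat (mfact \<gamma>) * Poly_Mapping.lookup (g \<circ>\<^sub>D complete_symmetric e) \<gamma> =
      (\<Sum>\<alpha>\<in>Poly_Mapping.keys g. if mdeg \<gamma> + i = e
         then Poly_Mapping.lookup g \<alpha> * of_nat (mfact (\<gamma> + \<alpha>)) else 0)"
    unfolding lookup_diff_act sum_distrib_left
  proof (intro sum.cong refl)
    fix \<alpha> assume "\<alpha> \<in> Poly_Mapping.keys g"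
    then have "mdeg \<alpha> = i" using assms by (auto simp: forms_def)
    then show "of_nat (mfact \<gamma>) * (Poly_Mapping.lookup g \<alpha> *
        Poly_Mapping.lookup (monom_deriv \<alpha> (complete_symmetric e)) \<gamma>) =
        (if mdeg \<gamma> + i = e then Poly_Mapping.lookup g \<alpha> * of_nat (mfact (\<gamma> + \<alpha>)) else 0)"
      by (simp add: lookup_monom_deriv lookup_complete_symmetric mdeg_add
           mfact_mult_pochhammer [symmetric] mult_ac)
  qed
  also have "\<dots> = (if mdeg \<gamma> + i = e then
      \<Sum>\<alpha>\<in>Poly_Mapping.keys g. Poly_Mapping.lookup g \<alpha> * of_nat (mfact (\<gamma> + \<alpha>)) else 0)"
    by simp
  also have "(\<Sum>\<alpha>\<in>Poly_Mapping.keys g. Poly_Mapping.lookup g \<alpha> * of_nat (mfact (\<gamma> + \<alpha>))) =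
      fact_functional ((\<Sum>\<alpha>\<in>Poly_Mapping.keys g. Poly_Mapping.single \<alpha> (Poly_Mapping.lookup g \<alpha>))
        * Poly_Mapping.single \<gamma> 1)"
    by (simp add: sum_distrib_right mult_single fact_functional_sum fact_functional_single add.commute)
  finally show ?thesis by (simp add: sum_singles)
qed

text \<open>In characteristic 0 the factor \<gamma>! is invertible, so all coefficients of the
  derivative vanish iff \<phi>(g x) = 0 for every monomial x of degree \<open>e - i\<close>;
  linearity extends this to forms. For \<open>i > e\<close> the condition is vacuous: such forms
  always annihilate.\<close>

lemma in_ann_complete_symmetric_iff:
  fixes g :: "('n::finite, 'k::field_char_0) mpoly"
  assumes "g \<in> forms i"
  shows "g \<in> ann (complete_symmetric e) \<longleftrightarrow>
     (i \<le> e \<longrightarrow> (\<forall>h\<in>forms (e - i). fact_functional (g * h) = 0))"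
proof -
  have nz: "(of_nat (mfact \<gamma>) :: 'k) \<noteq> 0" for \<gamma> :: "'n \<Rightarrow>\<^sub>0 nat"
    using mfact_pos [of \<gamma>] by simp
  have "g \<in> ann (complete_symmetric e) \<longleftrightarrow>
      (\<forall>\<gamma>. of_nat (mfact \<gamma>) * Poly_Mapping.lookup (g \<circ>\<^sub>D complete_symmetric e) \<gamma> = 0)"
    by (simp add: ann_def poly_mapping_eq_iff fun_eq_iff nz del: of_nat_eq_0_iff)
  also have "\<dots> \<longleftrightarrow> (\<forall>\<gamma>. mdeg \<gamma> + i = e \<longrightarrow> fact_functional (g * Poly_Mapping.single \<gamma> 1) = 0)"
    by (simp add: lookup_diff_act_complete_symmetric [OF assms])
  also have "\<dots> \<longleftrightarrow> (i \<le> e \<longrightarrow> (\<forall>h\<in>forms (e - i). fact_functional (g * h) = 0))"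
  proof (intro iffI impI ballI allI)
    fix h :: "('n, 'k) mpoly"
    assume *: "\<forall>\<gamma>. mdeg \<gamma> + i = e \<longrightarrow> fact_functional (g * Poly_Mapping.single \<gamma> 1) = 0"
      and "i \<le> e" and h: "h \<in> forms (e - i)"
    have "fact_functional (g * h) = (\<Sum>\<alpha>\<in>{\<alpha>. mdeg \<alpha> = e - i}.
        fact_functional (Const (Poly_Mapping.lookup h \<alpha>) * (g * Poly_Mapping.single \<alpha> 1)))"
      by (subst form_expand [OF h])
         (simp add: sum_distrib_left fact_functional_sum mult.left_commute)
    also have "\<dots> = 0"
      using * \<open>i \<le> e\<close> by (intro sum.neutral) (auto simp: fact_functional_Const_mult)
    finally show "fact_functional (g * h) = 0" .
  qed auto
  finally show ?thesis .
qed

section \<open>Multiplication by the sum of the variables\<close>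

lemma Var_mult_single:
  fixes c :: "'k::comm_semiring_1"
  shows "Var v * Poly_Mapping.single \<gamma> c =
    Poly_Mapping.single (\<gamma> + Poly_Mapping.single v 1) c"
  by (simp add: Var_def mult_single add.commute)

text \<open>Raising the exponent of \<open>v\<close> multiplies \<alpha>! by one more than the old
  exponent. Summed over all variables these factors give the degree plus the number of variables,
  the same for every monomial of the form.\<close>

lemma fact_functional_sum_vars_mult:
  fixes f :: "('n::finite, 'k::comm_semiring_1) mpoly"
  assumes "f \<in> forms d"
  shows "fact_functional (linear_form (\<lambda>_. 1) * f) = of_nat (d + card (UNIV :: 'n set)) * fact_functional f"
proof -
  let ?l = "linear_form (\<lambda>_. 1) :: ('n, 'k) mpoly"
  have Const1: "(Const 1 :: ('n, 'k) mpoly) = 1"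
    by (simp add: Const_def)
  have single: "fact_functional (?l * Poly_Mapping.single \<alpha> 1) =
      of_nat (d + card (UNIV :: 'n set)) * of_nat (mfact \<alpha>)" if "mdeg \<alpha> = d" for \<alpha>
  proof -
    have "fact_functional (?l * Poly_Mapping.single \<alpha> 1) =
        (\<Sum>v\<in>UNIV. of_nat (Suc (Poly_Mapping.lookup \<alpha> v) * mfact \<alpha>))"
      by (simp only: linear_form_def sum_distrib_right fact_functional_sum Var_mult_single Const1
          fact_functional_single mfact_add_single mult_1_left)
    also have "\<dots> = of_nat ((\<Sum>v\<in>UNIV. Suc (Poly_Mapping.lookup \<alpha> v)) * mfact \<alpha>)"
      by (simp only: of_nat_sum [symmetric] sum_distrib_right)
    also have "(\<Sum>v\<in>UNIV. Suc (Poly_Mapping.lookup \<alpha> v)) = d + card (UNIV :: 'n set)"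
      using that by (simp add: mdeg_def sum_Suc)
    finally show ?thesis by (simp only: of_nat_mult)
  qed
  let ?e = "\<lambda>\<alpha>. Const (Poly_Mapping.lookup f \<alpha>) * Poly_Mapping.single \<alpha> 1"
  have "fact_functional (?l * f) = fact_functional (?l * (\<Sum>\<alpha>\<in>{\<alpha>. mdeg \<alpha> = d}. ?e \<alpha>))"
    by (simp only: form_expand [OF assms, symmetric])
  also have "\<dots> = (\<Sum>\<alpha>\<in>{\<alpha>. mdeg \<alpha> = d}. Poly_Mapping.lookup f \<alpha> * fact_functional (?l * Poly_Mapping.single \<alpha> 1))"
    by (simp only: sum_distrib_left fact_functional_sum fact_functional_Const_mult
        mult.left_commute [of ?l])
  also have "\<dots> = of_nat (d + card (UNIV :: 'n set)) * fact_functional (\<Sum>\<alpha>\<in>{\<alpha>. mdeg \<alpha> = d}. ?e \<alpha>)"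
    by (simp add: single fact_functional_sum fact_functional_Const_mult fact_functional_single
        sum_distrib_left mult.left_commute del: of_nat_add)
  also have "(\<Sum>\<alpha>\<in>{\<alpha>. mdeg \<alpha> = d}. ?e \<alpha>) = f"
    by (rule form_expand [OF assms, symmetric])
  finally show ?thesis .
qed

text \<open>Each multiplication raises the degree by one, so the successive factors increase by one
  and form a Pochhammer symbol.\<close>

lemma fact_functional_sum_vars_power_mult:
  fixes f :: "('n::finite, 'k::comm_semiring_1) mpoly"
  assumes "f \<in> forms d"
  shows "fact_functional (linear_form (\<lambda>_. 1) ^ m * f) =
     of_nat (pochhammer (d + card (UNIV :: 'n set)) m) * fact_functional f"
proof (induction m)
  case (Suc m)
  let ?l = "linear_form (\<lambda>_. 1) :: ('n, 'k) mpoly"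
  have "fact_functional (?l ^ Suc m * f) = fact_functional (?l * (?l ^ m * f))"
    by (simp add: mult.assoc)
  also have "\<dots> = of_nat (m + d + card (UNIV :: 'n set)) *
      (of_nat (pochhammer (d + card (UNIV :: 'n set)) m) * fact_functional f)"
    by (simp only: fact_functional_sum_vars_mult [OF linear_form_power_mult_in_forms [OF assms]] Suc.IH)
  also have "\<dots> = of_nat (pochhammer (d + card (UNIV :: 'n set)) (Suc m)) * fact_functional f"
    by (simp only: pochhammer_Suc of_nat_mult of_nat_id mult_ac add_ac)
  finally show ?case .
qed simp

section \<open>Determinants over finite index sets\<close>

definition enumeration :: "'a set \<Rightarrow> nat \<Rightarrow> 'a" where
  "enumeration A = (SOME f. bij_betw f {0..<card A} A)"

text \<open>Matrices are indexed by numbers, the pairings by exponents. One arbitrary but fixed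
  enumeration orders both rows and columns; the lemmas below eliminate it again.\<close>

definition matrix_on :: "'a set \<Rightarrow> ('a \<Rightarrow> 'a \<Rightarrow> 'b) \<Rightarrow> 'b mat" where
  "matrix_on A M =
     mat (card A) (card A) (\<lambda>(i, j). M (enumeration A i) (enumeration A j))"

lemma bij_betw_enumeration: "finite A \<Longrightarrow> bij_betw (enumeration A) {0..<card A} A"
  unfolding enumeration_def by (rule someI_ex [OF ex_bij_betw_nat_finite])

lemma matrix_on_carrier [simp]: "matrix_on A M \<in> carrier_mat (card A) (card A)"
  by (simp add: matrix_on_def)

lemma sum_enumeration:
  "finite A \<Longrightarrow> (\<Sum>j = 0..<card A. f (enumeration A j)) = sum f A"
  by (rule sum.reindex_bij_betw [OF bij_betw_enumeration])

lemma matrix_on_mult_vec: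
  assumes "finite A"
  shows "matrix_on A M *\<^sub>v vec (card A) (\<lambda>j. c (enumeration A j)) =
     vec (card A) (\<lambda>i. \<Sum>y\<in>A. M (enumeration A i) y * c y)"
  using sum_enumeration [OF assms, of "\<lambda>y. M (enumeration A _) y * c y"]
  by (intro eq_vecI) (auto simp: matrix_on_def scalar_prod_def)

lemma vec_enumeration_eq_iff:
  assumes "finite A"
  shows "vec (card A) (\<lambda>i. f (enumeration A i)) = vec (card A) (\<lambda>i. g (enumeration A i)) \<longleftrightarrow>
     (\<forall>x\<in>A. f x = g x)"
proof -
  have "A = enumeration A ` {0..<card A}"
    using bij_betw_enumeration [OF assms] by (simp add: bij_betw_def)
  then have "(\<forall>x\<in>A. f x = g x) \<longleftrightarrow> (\<forall>x\<in>enumeration A ` {0..<card A}. f x = g x)"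
    by simp
  then show ?thesis
    by (auto simp: vec_eq_iff)
qed

lemma obtain_enumeration_vec:
  assumes "finite A" and "v \<in> carrier_vec (card A)"
  obtains c where "v = vec (card A) (\<lambda>j. c (enumeration A j))"
proof
  let ?i = "inv_into {0..<card A} (enumeration A)"
  have "?i (enumeration A j) = j" if "j < card A" for j
    using bij_betw_enumeration [OF assms(1)] that by (auto simp: bij_betw_def)
  then show "v = vec (card A) (\<lambda>j. (\<lambda>x. v $ ?i x) (enumeration A j))"
    using assms(2) by (intro eq_vecI) auto
qed

text \<open>The kernel criterion is stated over an integral domain because it is applied both over
  \<open>int\<close>, where squares are nonnegative, and over the base field.\<close>

lemma det_matrix_on_nonzero_iff:
  fixes M :: "'a \<Rightarrow> 'a \<Rightarrow> 'b::idom"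
  assumes "finite A"
  shows "det (matrix_on A M) \<noteq> 0 \<longleftrightarrow>
     (\<forall>c. (\<forall>x\<in>A. (\<Sum>y\<in>A. M x y * c y) = 0) \<longrightarrow> (\<forall>x\<in>A. c x = 0))"
proof -
  have zero: "0\<^sub>v (card A) = vec (card A) (\<lambda>i. (\<lambda>_. 0) (enumeration A i))"
    by (auto simp: zero_vec_def)
  let ?v = "\<lambda>c. vec (card A) (\<lambda>j. c (enumeration A j))"
  have "det (matrix_on A M) = 0 \<longleftrightarrow>
      (\<exists>v. v \<in> carrier_vec (card A) \<and> v \<noteq> 0\<^sub>v (card A) \<and> matrix_on A M *\<^sub>v v = 0\<^sub>v (card A))"
    by (rule det_0_iff_vec_prod_zero) simp
  also have "\<dots> \<longleftrightarrow> (\<exists>c. ?v c \<noteq> 0\<^sub>v (card A) \<and> matrix_on A M *\<^sub>v ?v c = 0\<^sub>v (card A))"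
    by (metis obtain_enumeration_vec [OF assms] vec_carrier)
  also have "\<dots> \<longleftrightarrow> (\<exists>c. \<not> (\<forall>x\<in>A. c x = 0) \<and> (\<forall>x\<in>A. (\<Sum>y\<in>A. M x y * c y) = 0))"
    unfolding zero matrix_on_mult_vec [OF assms] vec_enumeration_eq_iff [OF assms, of _ "\<lambda>_. 0"]
      vec_enumeration_eq_iff [OF assms, of "\<lambda>x. \<Sum>y\<in>A. M x y * _ y" "\<lambda>_. 0"] ..
  finally show ?thesis by blast
qed

lemma det_matrix_on_nonzero_solve:
  fixes M :: "'a \<Rightarrow> 'a \<Rightarrow> 'b::field"
  assumes "finite A" and "det (matrix_on A M) \<noteq> 0"
  obtains c where "\<forall>x\<in>A. (\<Sum>y\<in>A. M x y * c y) = b x"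
proof -
  let ?n = "card A"
  let ?b = "vec ?n (\<lambda>i. b (enumeration A i))"
  \<comment> \<open>Over a field the matrix is invertible; the solution \<open>c\<close> consists of
    the coordinates of the inverse \<open>B\<close> applied to the right-hand side.\<close>
  have "matrix_on A M \<in> Units (ring_mat TYPE('b) ?n ())"
    by (rule det_non_zero_imp_unit) (use assms(2) in simp_all)
  then obtain B where B: "B \<in> carrier_mat ?n ?n" and inv: "matrix_on A M * B = 1\<^sub>m ?n"
    unfolding Units_def ring_mat_def by auto
  have "B *\<^sub>v ?b \<in> carrier_vec ?n"
    using B by simp
  then obtain c where c: "B *\<^sub>v ?b = vec ?n (\<lambda>j. c (enumeration A j))"
    by (rule obtain_enumeration_vec [OF assms(1)])
  have "matrix_on A M *\<^sub>v (B *\<^sub>v ?b) = ?b"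
    using B inv by (simp add: assoc_mult_mat_vec [of _ ?n ?n _ ?n, symmetric])
  then show thesis
    using that vec_enumeration_eq_iff [OF assms(1), of "\<lambda>x. \<Sum>y\<in>A. M x y * c y" b]
    unfolding c matrix_on_mult_vec [OF assms(1)] by blast
qed

text \<open>Used for two homomorphisms: evaluation of polynomials at the coefficients of \<ell>, and
  the embedding of the integers into the base field.\<close>

lemma (in comm_ring_hom) hom_det_matrix_on:
  "hom (det (matrix_on A M)) = det (matrix_on A (\<lambda>x y. hom (M x y)))"
proof -
  have "map_mat hom (matrix_on A M) = matrix_on A (\<lambda>x y. hom (M x y))"
    by (auto simp: matrix_on_def)
  then show ?thesis by (metis hom_det)
qed

section \<open>The factorial matrix as a Gram matrix\<close>

text \<open>Vandermonde's identity, with the summation extended by zero terms to a bound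
  \<open>n\<close> that does not depend on \<open>a\<close>, so that all matrix entries get the same
  range.\<close>

lemma choose_add_eq_sum:
  assumes "a \<le> n"
  shows "(a + b) choose a = (\<Sum>s\<le>n. (a choose s) * (b choose s))"
proof -
  have "(a + b) choose a = (\<Sum>s\<le>a. (b choose s) * (a choose (a - s)))"
    using vandermonde [of b a a] by (simp add: add.commute)
  also have "\<dots> = (\<Sum>s\<le>a. (a choose s) * (b choose s))"
    by (intro sum.cong) (auto simp: binomial_symmetric [symmetric])
  also have "\<dots> = (\<Sum>s\<le>n. (a choose s) * (b choose s))"
    using assms by (intro sum.mono_neutral_left) auto
  finally show ?thesis .
qed

lemma lookup_le_mdeg: "Poly_Mapping.lookup \<alpha> v \<le> mdeg \<alpha>"
  unfolding mdeg_def by (rule member_le_sum) auto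

text \<open>Vandermonde in each variable, with the product of sums expanded over all choices
  \<sigma>. Every summand is a factor in \<alpha> times the same factor in \<beta>, as a Gram matrix
  requires.\<close>

lemma mfact_add_eq_sum:
  fixes \<alpha> \<beta> :: "'n::finite \<Rightarrow>\<^sub>0 nat"
  assumes "mdeg \<alpha> \<le> n"
  shows "mfact (\<alpha> + \<beta>) = (\<Sum>\<sigma>\<in>UNIV \<rightarrow>\<^sub>E {..n}.
     (mfact \<alpha> * (\<Prod>v\<in>UNIV. Poly_Mapping.lookup \<alpha> v choose \<sigma> v)) *
     (mfact \<beta> * (\<Prod>v\<in>UNIV. Poly_Mapping.lookup \<beta> v choose \<sigma> v)))"
proof -
  have "fact (a + b) = fact a * fact b * ((a + b) choose a)" for a b :: nat
    using binomial_fact_lemma [of a "a + b"] by simp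
  then have "mfact (\<alpha> + \<beta>) = mfact \<alpha> * mfact \<beta> * (\<Prod>v\<in>UNIV.
      (Poly_Mapping.lookup \<alpha> v + Poly_Mapping.lookup \<beta> v) choose Poly_Mapping.lookup \<alpha> v)"
    by (simp add: mfact_def lookup_add prod.distrib)
  also have "(\<Prod>v\<in>UNIV. (Poly_Mapping.lookup \<alpha> v + Poly_Mapping.lookup \<beta> v) choose Poly_Mapping.lookup \<alpha> v) =
      (\<Prod>v\<in>UNIV. \<Sum>s\<le>n. (Poly_Mapping.lookup \<alpha> v choose s) * (Poly_Mapping.lookup \<beta> v choose s))"
    by (intro prod.cong refl choose_add_eq_sum order.trans [OF lookup_le_mdeg assms])
  also have "\<dots> = (\<Sum>\<sigma>\<in>UNIV \<rightarrow>\<^sub>E {..n}. \<Prod>v\<in>UNIV.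
      (Poly_Mapping.lookup \<alpha> v choose \<sigma> v) * (Poly_Mapping.lookup \<beta> v choose \<sigma> v))"
    by (rule prod_sum_PiE) auto
  finally show ?thesis
    by (simp add: sum_distrib_left prod.distrib mult_ac)
qed

text \<open>If no coordinate of \<alpha> were below that of \<beta>, a differing coordinate would
  make the degree of \<alpha> strictly larger. A coordinate that is below contributes a zero
  binomial.\<close>

lemma prod_choose_eq_0:
  fixes \<alpha> \<beta> :: "'n::finite \<Rightarrow>\<^sub>0 nat"
  assumes "mdeg \<alpha> = mdeg \<beta>" and "\<alpha> \<noteq> \<beta>"
  shows "(\<Prod>v\<in>UNIV. Poly_Mapping.lookup \<alpha> v choose Poly_Mapping.lookup \<beta> v) = 0"
proof -
  have "\<exists>v. Poly_Mapping.lookup \<alpha> v < Poly_Mapping.lookup \<beta> v"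
  proof (rule ccontr)
    assume *: "\<not> ?thesis"
    obtain u where "Poly_Mapping.lookup \<alpha> u \<noteq> Poly_Mapping.lookup \<beta> u"
      using assms(2) by (metis poly_mapping_eqI)
    with * have "Poly_Mapping.lookup \<beta> u < Poly_Mapping.lookup \<alpha> u"
      by (metis nat_neq_iff)
    with * have "mdeg \<beta> < mdeg \<alpha>"
      unfolding mdeg_def by (intro sum_strict_mono_ex1) (auto simp: not_less)
    with assms(1) show False by simp
  qed
  then show ?thesis by auto
qed

text \<open>By \<open>mfact_add_eq_sum\<close> the matrix is a Gram matrix over the integers.\<close>

lemma det_mfact_matrix_nonzero:
  "det (matrix_on {\<alpha> :: 'n::finite \<Rightarrow>\<^sub>0 nat. mdeg \<alpha> = d} (\<lambda>\<alpha> \<beta>. int (mfact (\<alpha> + \<beta>)))) \<noteq> 0"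
  unfolding det_matrix_on_nonzero_iff [OF finite_mdeg]
proof (intro allI impI ballI)
  let ?A = "{\<alpha> :: 'n \<Rightarrow>\<^sub>0 nat. mdeg \<alpha> = d}"
  let ?B = "(UNIV :: 'n set) \<rightarrow>\<^sub>E {..d}"
  fix c :: "('n \<Rightarrow>\<^sub>0 nat) \<Rightarrow> int" and \<tau> :: "'n \<Rightarrow>\<^sub>0 nat"
  assume ker: "\<forall>\<alpha>\<in>?A. (\<Sum>\<beta>\<in>?A. int (mfact (\<alpha> + \<beta>)) * c \<beta>) = 0" and \<tau>: "\<tau> \<in> ?A"
  \<comment> \<open>The entries of the Gram factor. The quadratic form of the matrix at
    \<open>c\<close> becomes a sum of squares over \<sigma>, and it vanishes because
    \<open>c\<close> lies in the kernel.\<close>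
  define p where "p \<alpha> \<sigma> = int (mfact \<alpha> * (\<Prod>v\<in>UNIV. Poly_Mapping.lookup \<alpha> v choose \<sigma> v))"
    for \<alpha> :: "'n \<Rightarrow>\<^sub>0 nat" and \<sigma> :: "'n \<Rightarrow> nat"
  have finB: "finite ?B"
    by (intro finite_PiE) auto
  have "(\<Sum>\<sigma>\<in>?B. (\<Sum>\<alpha>\<in>?A. c \<alpha> * p \<alpha> \<sigma>)\<^sup>2) =
      (\<Sum>\<sigma>\<in>?B. \<Sum>\<alpha>\<in>?A. \<Sum>\<beta>\<in>?A. c \<alpha> * c \<beta> * (p \<alpha> \<sigma> * p \<beta> \<sigma>))"
    by (simp add: power2_eq_square sum_product mult_ac)
  also have "\<dots> = (\<Sum>\<alpha>\<in>?A. \<Sum>\<sigma>\<in>?B. \<Sum>\<beta>\<in>?A. c \<alpha> * c \<beta> * (p \<alpha> \<sigma> * p \<beta> \<sigma>))"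
    by (rule sum.swap)
  also have "\<dots> = (\<Sum>\<alpha>\<in>?A. \<Sum>\<beta>\<in>?A. \<Sum>\<sigma>\<in>?B. c \<alpha> * c \<beta> * (p \<alpha> \<sigma> * p \<beta> \<sigma>))"
    by (intro sum.cong refl) (rule sum.swap)
  also have "\<dots> = (\<Sum>\<alpha>\<in>?A. \<Sum>\<beta>\<in>?A. c \<alpha> * c \<beta> * int (mfact (\<alpha> + \<beta>)))"
    by (intro sum.cong refl) (simp add: mfact_add_eq_sum [of _ d] p_def sum_distrib_left)
  also have "\<dots> = (\<Sum>\<alpha>\<in>?A. c \<alpha> * (\<Sum>\<beta>\<in>?A. int (mfact (\<alpha> + \<beta>)) * c \<beta>))"
    by (simp add: sum_distrib_left mult_ac)
  also have "\<dots> = 0"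
    using ker by simp
  finally have "(\<Sum>\<sigma>\<in>?B. (\<Sum>\<alpha>\<in>?A. c \<alpha> * p \<alpha> \<sigma>)\<^sup>2) = 0" .
  then have "\<forall>\<sigma>\<in>?B. (\<Sum>\<alpha>\<in>?A. c \<alpha> * p \<alpha> \<sigma>)\<^sup>2 = 0"
    using sum_nonneg_eq_0_iff [OF finB, of "\<lambda>\<sigma>. (\<Sum>\<alpha>\<in>?A. c \<alpha> * p \<alpha> \<sigma>)\<^sup>2"] by simp
  \<comment> \<open>Choosing \<sigma> as the exponent vector of \<tau> isolates
    \<open>c \<tau>\<close>: within degree \<open>d\<close> the binomial product is 1 at \<tau> and
    0 elsewhere.\<close>
  moreover have "Poly_Mapping.lookup \<tau> \<in> ?B"
    using lookup_le_mdeg [of \<tau>] \<tau> by auto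
  ultimately have "(\<Sum>\<alpha>\<in>?A. c \<alpha> * p \<alpha> (Poly_Mapping.lookup \<tau>)) = 0"
    by simp
  also have "(\<Sum>\<alpha>\<in>?A. c \<alpha> * p \<alpha> (Poly_Mapping.lookup \<tau>)) =
      (\<Sum>\<alpha>\<in>?A. if \<alpha> = \<tau> then c \<tau> * int (mfact \<tau>) else 0)"
    using \<tau> by (intro sum.cong refl) (auto simp: p_def dest!: prod_choose_eq_0 [rotated])
  also have "\<dots> = c \<tau> * int (mfact \<tau>)"
    using \<tau> by (simp add: finite_mdeg)
  finally show "c \<tau> = 0"
    using mfact_pos [of \<tau>] by simp
qed

section \<open>The Lefschetz determinants\<close>

lemma eval_mpoly_add: "eval_mpoly a (f + g) = eval_mpoly a f + eval_mpoly a g"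
  unfolding eval_mpoly_def by (rule setsum_keys_plus_distrib) (simp_all add: distrib_right)

lemma eval_mpoly_single:
  "eval_mpoly a (Poly_Mapping.single \<alpha> c) = c * (\<Prod>v\<in>UNIV. a v ^ Poly_Mapping.lookup \<alpha> v)"
  by (cases "c = 0") (auto simp: eval_mpoly_def)

lemma eval_mpoly_sum: "eval_mpoly a (\<Sum>x\<in>A. f x) = (\<Sum>x\<in>A. eval_mpoly a (f x))"
  by (induction A rule: infinite_finite_induct)
     (simp_all add: eval_mpoly_add eval_mpoly_def [of _ 0])

lemma eval_mpoly_mult: "eval_mpoly a (f * g) = eval_mpoly a f * eval_mpoly a g"
proof -
  let ?m = "\<lambda>f \<alpha>. Poly_Mapping.single \<alpha> (Poly_Mapping.lookup f \<alpha>)"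
  have "eval_mpoly a ((\<Sum>\<alpha>\<in>Poly_Mapping.keys f. ?m f \<alpha>) * (\<Sum>\<beta>\<in>Poly_Mapping.keys g. ?m g \<beta>)) =
      eval_mpoly a (\<Sum>\<alpha>\<in>Poly_Mapping.keys f. ?m f \<alpha>) * eval_mpoly a (\<Sum>\<beta>\<in>Poly_Mapping.keys g. ?m g \<beta>)"
    by (simp only: sum_product eval_mpoly_sum)
       (simp add: mult_single eval_mpoly_single lookup_add power_add prod.distrib mult_ac)
  then show ?thesis by (simp add: sum_singles)
qed

lemma eval_mpoly_Const: "eval_mpoly a (Const c) = c"
  by (simp add: Const_def eval_mpoly_single)

lemma eval_mpoly_Var: "eval_mpoly a (Var v) = a v"
proof -
  have "(\<Prod>u\<in>UNIV. a u ^ Poly_Mapping.lookup (Poly_Mapping.single v 1) u) =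
      (\<Prod>u\<in>UNIV. if u = v then a u else 1)"
    by (intro prod.cong) (auto simp: lookup_single when_def)
  then show ?thesis by (simp add: Var_def eval_mpoly_single)
qed

lemma comm_ring_hom_eval_mpoly: "comm_ring_hom (eval_mpoly a)"
proof
  show "eval_mpoly a 1 = 1"
    using eval_mpoly_Const [of a 1] by (simp add: Const_def)
qed (simp_all add: eval_mpoly_add eval_mpoly_mult eval_mpoly_def [of _ 0])

text \<open>The moments \<^term>\<open>fact_functional (linear_form a ^ m * Poly_Mapping.single \<gamma> 1)\<close>
  as polynomials in the coefficients \<open>a\<close> of the linear form.\<close>

primrec moment_poly :: "nat \<Rightarrow> ('n::finite \<Rightarrow>\<^sub>0 nat) \<Rightarrow> ('n, 'k::comm_semiring_1) mpoly" where
  "moment_poly 0 \<gamma> = Const (of_nat (mfact \<gamma>))"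
| "moment_poly (Suc m) \<gamma> = (\<Sum>v\<in>UNIV. Var v * moment_poly m (\<gamma> + Poly_Mapping.single v 1))"

text \<open>One factor \<ell> is moved onto the monomial, where \<ell> times a monomial is the sum
  over \<open>v\<close> of \<open>a v\<close> times the monomial with exponent of \<open>v\<close>
  raised. This is the recursion of \<open>moment_poly\<close>.\<close>

lemma eval_moment_poly:
  "eval_mpoly a (moment_poly m \<gamma>) = fact_functional (linear_form a ^ m * Poly_Mapping.single \<gamma> 1)"
proof (induction m arbitrary: \<gamma>)
  case 0
  then show ?case by (simp add: eval_mpoly_Const fact_functional_single)
next
  case (Suc m)
  have "linear_form a ^ Suc m * Poly_Mapping.single \<gamma> 1 =
      linear_form a ^ m * (\<Sum>v\<in>UNIV. Const (a v) * (Var v * Poly_Mapping.single \<gamma> 1))"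
    by (simp add: linear_form_def [of a] sum_distrib_right mult.assoc mult.left_commute power_Suc2 del: power_Suc)
  also have "\<dots> = (\<Sum>v\<in>UNIV. Const (a v) *
      (linear_form a ^ m * Poly_Mapping.single (\<gamma> + Poly_Mapping.single v 1) 1))"
    by (simp only: Var_mult_single sum_distrib_left mult.left_commute [of "linear_form a ^ m"])
  finally show ?case
    by (simp add: eval_mpoly_sum eval_mpoly_mult eval_mpoly_Var Suc.IH fact_functional_sum
        fact_functional_Const_mult del: power_Suc)
qed

text \<open>The Gram determinant of the pairing weighted by a power of \<ell>, kept as a polynomial
  in the coefficients of \<ell> so that its nonvanishing is a Zariski-open condition. The intended
  range is \<open>2 * i \<le> e\<close>, where the subtraction does not truncate.\<close>

definition lefschetz_det :: "nat \<Rightarrow> nat \<Rightarrow> ('n::finite, 'k::comm_ring_1) mpoly" where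
  "lefschetz_det e i = det (matrix_on {\<alpha>. mdeg \<alpha> = i} (\<lambda>\<alpha> \<beta>. moment_poly (e - 2 * i) (\<alpha> + \<beta>)))"

lemma eval_lefschetz_det:
  "eval_mpoly a (lefschetz_det e i) = det (matrix_on {\<alpha>. mdeg \<alpha> = i}
     (\<lambda>\<alpha> \<beta>. fact_functional (linear_form a ^ (e - 2 * i) * Poly_Mapping.single (\<alpha> + \<beta>) 1)))"
  unfolding lefschetz_det_def comm_ring_hom.hom_det_matrix_on [OF comm_ring_hom_eval_mpoly]
    eval_moment_poly ..

text \<open>Since \<alpha> + \<beta> always has degree \<open>2 * i\<close>, every entry is the
  factorial matrix entry times one common nonzero scalar. Both matrices then have the same kernel,
  and the integer determinant stays nonzero in characteristic 0.\<close>

lemma eval_lefschetz_det_sum_vars: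
  "eval_mpoly (\<lambda>_. 1) (lefschetz_det e i :: ('n::finite, 'k::field_char_0) mpoly) \<noteq> 0"
proof -
  let ?A = "{\<alpha> :: 'n \<Rightarrow>\<^sub>0 nat. mdeg \<alpha> = i}"
  let ?p = "of_nat (pochhammer (2 * i + card (UNIV :: 'n set)) (e - 2 * i)) :: 'k"
  \<comment> \<open>Positive even for \<open>i = 0\<close>, because there is at least one
    variable.\<close>
  have "pochhammer (2 * i + card (UNIV :: 'n set)) (e - 2 * i) > 0"
    by (intro pochhammer_pos) (simp add: card_gt_0_iff)
  then have p: "?p \<noteq> 0" by simp
  have hom: "comm_ring_hom (of_int :: int \<Rightarrow> 'k)"
    by standard simp_all
  have M: "fact_functional (linear_form (\<lambda>_. 1) ^ (e - 2 * i) * Poly_Mapping.single (\<alpha> + \<beta>) (1 :: 'k)) =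
      ?p * of_int (int (mfact (\<alpha> + \<beta>)))" if "\<alpha> \<in> ?A" "\<beta> \<in> ?A" for \<alpha> \<beta>
    using that fact_functional_sum_vars_power_mult [of "Poly_Mapping.single (\<alpha> + \<beta>) (1 :: 'k)" "2 * i"]
    by (simp add: mdeg_add mult_2 fact_functional_single)
  have "det (matrix_on ?A (\<lambda>\<alpha> \<beta>. of_int (int (mfact (\<alpha> + \<beta>))) :: 'k)) \<noteq> 0"
    using det_mfact_matrix_nonzero [where 'n = 'n and d = i]
    by (simp only: comm_ring_hom.hom_det_matrix_on [OF hom, symmetric] of_int_eq_0_iff not_False_eq_True)
  moreover have "(\<Sum>\<beta>\<in>?A. fact_functional (linear_form (\<lambda>_. 1) ^ (e - 2 * i) *
        Poly_Mapping.single (\<alpha> + \<beta>) 1) * c \<beta>) =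
      ?p * (\<Sum>\<beta>\<in>?A. of_int (int (mfact (\<alpha> + \<beta>))) * c \<beta>)" if "\<alpha> \<in> ?A" for \<alpha> c
    unfolding sum_distrib_left using that by (intro sum.cong refl) (simp add: M)
  ultimately show ?thesis
    unfolding eval_lefschetz_det det_matrix_on_nonzero_iff [OF finite_mdeg]
    using p by simp
qed

section \<open>Nondegeneracy of the pairing as injectivity and surjectivity\<close>

text \<open>The right-hand side is row \<alpha> of the pairing matrix applied to the coefficient
  vector of \<open>g\<close>, which links \<phi> to the determinant criteria.\<close>

lemma fact_functional_pairing:
  fixes g :: "('n::finite, 'k::comm_semiring_1) mpoly"
  assumes "g \<in> forms i"
  shows "fact_functional (f * g * Poly_Mapping.single \<alpha> 1) =
     (\<Sum>\<beta>\<in>{\<beta>. mdeg \<beta> = i}.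
        fact_functional (f * Poly_Mapping.single (\<alpha> + \<beta>) 1) * Poly_Mapping.lookup g \<beta>)"
proof -
  let ?e = "\<lambda>\<beta>. Const (Poly_Mapping.lookup g \<beta>) * Poly_Mapping.single \<beta> 1"
  have *: "f * ?e \<beta> * Poly_Mapping.single \<alpha> 1 =
      Const (Poly_Mapping.lookup g \<beta>) * (f * Poly_Mapping.single (\<alpha> + \<beta>) 1)" for \<beta>
  proof -
    have "Poly_Mapping.single (\<alpha> + \<beta>) (1 :: 'k) = Poly_Mapping.single \<beta> 1 * Poly_Mapping.single \<alpha> 1"
      by (simp add: mult_single add.commute)
    then show ?thesis by (simp only: mult_ac)
  qed
  have "fact_functional (f * g * Poly_Mapping.single \<alpha> 1) =
      fact_functional (f * (\<Sum>\<beta>\<in>{\<beta>. mdeg \<beta> = i}. ?e \<beta>) * Poly_Mapping.single \<alpha> 1)"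
    by (simp only: form_expand [OF assms, symmetric])
  then show ?thesis
    by (simp only: sum_distrib_left sum_distrib_right * fact_functional_sum fact_functional_Const_mult
        mult.commute [of "Poly_Mapping.lookup g _"])
qed

text \<open>Testing the annihilator condition against \<ell> to the power
  \<open>e - 2 * i - j\<close> times a monomial of degree \<open>i\<close> completes the power of
  \<ell> to \<open>e - 2 * i\<close>. So the coefficients of \<open>g\<close> lie in the kernel of
  the matrix.\<close>

lemma lefschetz_injective:
  fixes g :: "('n::finite, 'k::field_char_0) mpoly"
  assumes "eval_mpoly a (lefschetz_det e i) \<noteq> 0" and "2 * i + j \<le> e" and g: "g \<in> forms i"
    and "linear_form a ^ j * g \<in> ann (complete_symmetric e)"
  shows "g = 0"
proof -
  let ?A = "{\<alpha> :: 'n \<Rightarrow>\<^sub>0 nat. mdeg \<alpha> = i}"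
  have "fact_functional (linear_form a ^ (e - 2 * i) * g * Poly_Mapping.single \<alpha> 1) = 0"
    if "\<alpha> \<in> ?A" for \<alpha>
  proof -
    let ?h = "linear_form a ^ (e - 2 * i - j) * Poly_Mapping.single \<alpha> 1 :: ('n, 'k) mpoly"
    have "e - 2 * i - j + i = e - (j + i)"
      using assms(2) by simp
    then have "?h \<in> forms (e - (j + i))"
      using linear_form_power_mult_in_forms [of "Poly_Mapping.single \<alpha> 1" i a "e - 2 * i - j"] that
      by simp
    then have "fact_functional (linear_form a ^ j * g * ?h) = 0"
      using in_ann_complete_symmetric_iff [OF linear_form_power_mult_in_forms [OF g, of a j], of e]
        assms(2,4) by simp
    moreover have "linear_form a ^ (e - 2 * i) = linear_form a ^ j * linear_form a ^ (e - 2 * i - j)"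
      using assms(2) by (simp add: power_add [symmetric])
    ultimately show ?thesis by (simp only: mult_ac)
  qed
  then have "\<forall>\<alpha>\<in>?A. Poly_Mapping.lookup g \<alpha> = 0"
    using assms(1) unfolding eval_lefschetz_det det_matrix_on_nonzero_iff [OF finite_mdeg]
      fact_functional_pairing [OF g] by blast
  then show ?thesis
    using form_expand [OF g] by (simp add: Const_def)
qed

text \<open>Solving the linear system gives \<open>g\<close> such that the difference is orthogonal
  under \<phi> to all monomials of degree \<open>i\<close>, the degree complementary to
  \<open>e - i\<close>.\<close>

lemma lefschetz_surjective:
  fixes f :: "('n::finite, 'k::field_char_0) mpoly"
  assumes "eval_mpoly a (lefschetz_det e i) \<noteq> 0" and "2 * i \<le> e" and f: "f \<in> forms (e - i)"
  obtains g where "g \<in> forms i" and "f - linear_form a ^ (e - 2 * i) * g \<in> ann (complete_symmetric e)"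
proof -
  let ?A = "{\<alpha> :: 'n \<Rightarrow>\<^sub>0 nat. mdeg \<alpha> = i}"
  let ?L = "linear_form a ^ (e - 2 * i)"
  obtain c where c: "\<forall>\<alpha>\<in>?A. (\<Sum>\<beta>\<in>?A. fact_functional (?L * Poly_Mapping.single (\<alpha> + \<beta>) 1) * c \<beta>) =
      fact_functional (f * Poly_Mapping.single \<alpha> 1)"
    using det_matrix_on_nonzero_solve [OF finite_mdeg assms(1) [unfolded eval_lefschetz_det]] .
  define g :: "('n, 'k) mpoly" where "g = (\<Sum>\<beta>\<in>?A. Poly_Mapping.single \<beta> (c \<beta>))"
  have g: "g \<in> forms i"
    unfolding g_def by (intro forms_sum) simp
  have lookup_g: "Poly_Mapping.lookup g \<beta> = c \<beta>" if "\<beta> \<in> ?A" for \<beta>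
    using that by (simp add: g_def lookup_sum lookup_single when_def finite_mdeg)
  have deg: "e - 2 * i + i = e - i" "e - (e - i) = i" "e - i \<le> e"
    using assms(2) by simp_all
  have Lg: "?L * g \<in> forms (e - i)"
    using linear_form_power_mult_in_forms [OF g, of a "e - 2 * i"] by (simp only: deg)
  have mono: "fact_functional ((f - ?L * g) * Poly_Mapping.single \<alpha> 1) = 0" if "\<alpha> \<in> ?A" for \<alpha>
  proof -
    have "fact_functional (?L * g * Poly_Mapping.single \<alpha> 1) =
        fact_functional (f * Poly_Mapping.single \<alpha> 1)"
      using c that by (simp add: fact_functional_pairing [OF g] lookup_g)
    moreover have "fact_functional (f * Poly_Mapping.single \<alpha> 1) =
        fact_functional ((f - ?L * g) * Poly_Mapping.single \<alpha> 1) +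
        fact_functional (?L * g * Poly_Mapping.single \<alpha> 1)"
      by (simp add: fact_functional_add [symmetric] left_diff_distrib)
    ultimately show ?thesis by simp
  qed
  have "fact_functional ((f - ?L * g) * h) = 0" if h: "h \<in> forms i" for h
  proof -
    have "fact_functional ((f - ?L * g) * h) = fact_functional ((f - ?L * g) *
        (\<Sum>\<alpha>\<in>?A. Const (Poly_Mapping.lookup h \<alpha>) * Poly_Mapping.single \<alpha> 1))"
      by (simp only: form_expand [OF h, symmetric])
    also have "\<dots> = 0"
      by (simp only: sum_distrib_left mult.left_commute [of "f - ?L * g"] fact_functional_sum
          fact_functional_Const_mult mono mult_zero_right sum.neutral_const cong: sum.cong)
    finally show ?thesis .
  qed
  then have "f - ?L * g \<in> ann (complete_symmetric e)"
    using in_ann_complete_symmetric_iff [OF forms_diff [OF f Lg], of e] unfolding deg by blast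
  with g show thesis by (rule that)
qed

section \<open>Dimensions and maximal rank\<close>

lemma mpoly_ring_simps [simp]:
  "carrier (mpoly_ring :: ('n::finite, 'k::comm_ring_1) mpoly ring) = UNIV"
  "x \<oplus>\<^bsub>mpoly_ring\<^esub> y = x + y"
  "x \<otimes>\<^bsub>mpoly_ring\<^esub> y = x * y"
  "\<zero>\<^bsub>mpoly_ring\<^esub> = (0 :: ('n, 'k) mpoly)"
  "\<one>\<^bsub>mpoly_ring\<^esub> = (1 :: ('n, 'k) mpoly)"
  for x y :: "('n::finite, 'k::comm_ring_1) mpoly"
  by (simp_all add: ring_of_type_algebra_def)

lemma cring_mpoly_ring: "cring (mpoly_ring :: ('n::finite, 'k::comm_ring_1) mpoly ring)"
  by (rule cring_from_type_algebra)

lemma mpoly_ring_minus: "x \<ominus>\<^bsub>mpoly_ring\<^esub> y = x - (y :: ('n::finite, 'k::comm_ring_1) mpoly)"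
proof -
  interpret R: cring "mpoly_ring :: ('n, 'k) mpoly ring" by (rule cring_mpoly_ring)
  have "\<ominus>\<^bsub>mpoly_ring\<^esub> y = - y"
    using R.minus_equality [of "- y" y] by simp
  then show ?thesis by (simp add: a_minus_def)
qed

lemma mpoly_ring_pow: "x [^]\<^bsub>mpoly_ring\<^esub> (n :: nat) = (x :: ('n::finite, 'k::comm_ring_1) mpoly) ^ n"
proof -
  interpret R: cring "mpoly_ring :: ('n, 'k) mpoly ring" by (rule cring_mpoly_ring)
  show ?thesis by (induction n) (simp_all add: mult.commute)
qed

lemma quot_class_eq_iff:
  "quot_class (ann f) g = quot_class (ann f) h \<longleftrightarrow> g - h \<in> ann (f :: ('n::finite, 'k::comm_ring_1) mpoly)"
proof -
  interpret R: cring "mpoly_ring :: ('n, 'k) mpoly ring" by (rule cring_mpoly_ring)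
  show ?thesis
    using R.quotient_eq_iff_same_a_r_cos [OF ideal_ann, of g h f] by (simp add: mpoly_ring_minus)
qed

lemma mult_map_quot_class:
  "mult_map (ann f) l j (quot_class (ann f) g) = quot_class (ann f) (l ^ j * g)"
  for f :: "('n::finite, 'k::comm_ring_1) mpoly"
proof -
  interpret h: ring_hom_ring mpoly_ring "mpoly_ring Quot ann f" "quot_class (ann f)"
    by (rule ideal.rcos_ring_hom_ring [OF ideal_ann])
  have "quot_class (ann f) l [^]\<^bsub>mpoly_ring Quot ann f\<^esub> j = quot_class (ann f) (l ^ j)"
    using h.hom_nat_pow [of l j] by (simp add: mpoly_ring_pow)
  then show ?thesis
    using h.hom_mult [of "l ^ j" g] by (simp add: mult_map_def)
qed

section \<open>Dimension over the constants\<close>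

lemma subfield_range_Const: "subfield (range Const) (mpoly_ring :: ('n::finite, 'k::field) mpoly ring)"
proof -
  interpret R: cring "mpoly_ring :: ('n, 'k) mpoly ring" by (rule cring_mpoly_ring)
  have "ring_hom_ring ring_of_type_algebra (mpoly_ring :: ('n, 'k) mpoly ring) Const"
    by (intro ring_hom_ringI R.ring_axioms ring_from_type_algebra)
       (simp_all add: ring_of_type_algebra_def Const_def mult_single single_add)
  then interpret h: ring_hom_ring ring_of_type_algebra "mpoly_ring :: ('n, 'k) mpoly ring" Const .
  interpret K: field "ring_of_type_algebra :: 'k ring" by (rule field_from_type_algebra)
  show ?thesis
    using h.img_is_subfield(2) [OF K.carrier_is_subfield] by (simp add: ring_of_type_algebra_def [where 'a = 'k])
qed

text \<open>A basis criterion: the images of the \<open>b x\<close> are independent and span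
  \<open>V\<close>. Linear combinations are formed before applying \<open>q\<close>, so one lemma
  serves the polynomial ring (with \<open>q = id\<close>) and its quotient.\<close>

lemma dim_eq_cardI:
  fixes q :: "('n::finite, 'k::field) mpoly \<Rightarrow> 'b"
  assumes hom: "ring_hom_ring mpoly_ring R q" and nontrivial: "\<one>\<^bsub>R\<^esub> \<noteq> \<zero>\<^bsub>R\<^esub>"
    and fin: "finite A"
    and indep: "\<And>c. q (\<Sum>x\<in>A. Const (c x) * b x) = \<zero>\<^bsub>R\<^esub> \<Longrightarrow> \<forall>x\<in>A. c x = 0"
    and V: "V = range (\<lambda>c. q (\<Sum>x\<in>A. Const (c x) * b x))"
  shows "(ring.dim R over (q ` range Const)) V = card A"
proof -
  interpret q: ring_hom_ring mpoly_ring R q by (rule hom)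
  let ?K = "q ` range Const"
  have K: "subfield ?K R"
    by (rule q.img_is_subfield(2) [OF subfield_range_Const nontrivial])
  have span: "q.S.Span ?K (map (q \<circ> b) xs) = range (\<lambda>c. q (\<Sum>x\<in>set xs. Const (c x) * b x))"
    if "distinct xs" for xs
    using that
  proof (induction xs)
    case Nil
    then show ?case using q.hom_zero by auto
  next
    case (Cons u xs)
    have "q.S.Span ?K (map (q \<circ> b) (u # xs)) =
        q.S.line_extension ?K (q (b u)) (q.S.Span ?K (map (q \<circ> b) xs))"
      by simp
    also have "q.S.Span ?K (map (q \<circ> b) xs) = range (\<lambda>c. q (\<Sum>x\<in>set xs. Const (c x) * b x))"
      by (rule Cons.IH) (use Cons.prems in simp)
    finally have Span: "q.S.Span ?K (map (q \<circ> b) (u # xs)) =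
        q.S.line_extension ?K (q (b u)) (range (\<lambda>c. q (\<Sum>x\<in>set xs. Const (c x) * b x)))" .
    show ?case
      unfolding Span
    proof (intro equalityI subsetI)
      fix y assume "y \<in> q.S.line_extension ?K (q (b u)) (range (\<lambda>c. q (\<Sum>x\<in>set xs. Const (c x) * b x)))"
      then obtain k c where y: "y = q (Const k) \<otimes>\<^bsub>R\<^esub> q (b u) \<oplus>\<^bsub>R\<^esub> q (\<Sum>x\<in>set xs. Const (c x) * b x)"
        by (auto simp: q.S.line_extension_mem_iff)
      \<comment> \<open>By distinctness \<open>u\<close> is not in \<open>xs\<close>, so its
        coefficient can be set without changing the tail.\<close>
      have "(\<Sum>x\<in>set xs. Const (c x) * b x) = (\<Sum>x\<in>set xs. Const ((c(u := k)) x) * b x)"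
        using Cons.prems by (intro sum.cong) auto
      then have "y = q (\<Sum>x\<in>set (u # xs). Const ((c(u := k)) x) * b x)"
        using Cons.prems q.hom_mult [of "Const k" "b u"]
          q.hom_add [of "Const k * b u" "\<Sum>x\<in>set xs. Const (c x) * b x"]
        by (simp add: y)
      then show "y \<in> range (\<lambda>c. q (\<Sum>x\<in>set (u # xs). Const (c x) * b x))"
        by blast
    next
      fix y assume "y \<in> range (\<lambda>c. q (\<Sum>x\<in>set (u # xs). Const (c x) * b x))"
      then obtain c where "y = q (\<Sum>x\<in>set (u # xs). Const (c x) * b x)" by blast
      then have y: "y = q (Const (c u)) \<otimes>\<^bsub>R\<^esub> q (b u) \<oplus>\<^bsub>R\<^esub> q (\<Sum>x\<in>set xs. Const (c x) * b x)"
        using Cons.prems q.hom_mult [of "Const (c u)" "b u"]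
          q.hom_add [of "Const (c u) * b u" "\<Sum>x\<in>set xs. Const (c x) * b x"]
        by simp
      then show "y \<in> q.S.line_extension ?K (q (b u)) (range (\<lambda>c. q (\<Sum>x\<in>set xs. Const (c x) * b x)))"
        unfolding q.S.line_extension_mem_iff by blast
    qed
  qed
  have independent: "q.S.independent ?K (map (q \<circ> b) xs)" if "distinct xs" "set xs \<subseteq> A" for xs
    using that
  proof (induction xs)
    case (Cons u xs)
    have "q (b u) \<notin> q.S.Span ?K (map (q \<circ> b) xs)"
    proof
      assume "q (b u) \<in> q.S.Span ?K (map (q \<circ> b) xs)"
      then obtain c where c: "q (b u) = q (\<Sum>x\<in>set xs. Const (c x) * b x)"
        using span [of xs] Cons.prems by auto
      \<comment> \<open>The relation that expresses \<open>b u\<close> by the tail, moved to one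
        side and extended by zero to all of \<open>A\<close>; its coefficient 1 at \<open>u\<close>
        contradicts \<open>indep\<close>.\<close>
      define c' where "c' x = (if x = u then 1 else if x \<in> set xs then - c x else 0)" for x
      have "(\<Sum>x\<in>A. Const (c' x) * b x) = (\<Sum>x\<in>set (u # xs). Const (c' x) * b x)"
        using Cons.prems fin by (intro sum.mono_neutral_right) (auto simp: c'_def Const_def)
      also have "\<dots> = b u + (\<Sum>x\<in>set xs. - (Const (c x) * b x))"
      proof -
        have "(\<Sum>x\<in>set xs. Const (c' x) * b x) = (\<Sum>x\<in>set xs. - (Const (c x) * b x))"
          using Cons.prems by (intro sum.cong) (auto simp: c'_def Const_def single_uminus)
        then show ?thesis using Cons.prems by (simp add: c'_def Const_def)
      qed
      finally have "(\<Sum>x\<in>A. Const (c' x) * b x) + (\<Sum>x\<in>set xs. Const (c x) * b x) = b u"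
        by (simp add: sum_negf)
      then have "q (\<Sum>x\<in>A. Const (c' x) * b x) \<oplus>\<^bsub>R\<^esub> q (b u) = q (b u)"
        using q.hom_add [of "\<Sum>x\<in>A. Const (c' x) * b x" "\<Sum>x\<in>set xs. Const (c x) * b x"] c by simp
      then have "q (\<Sum>x\<in>A. Const (c' x) * b x) = \<zero>\<^bsub>R\<^esub>"
        by simp
      then have "\<forall>x\<in>A. c' x = 0" by (rule indep)
      then have "c' u = 0" using Cons.prems(2) by simp
      then show False by (simp add: c'_def)
    qed
    moreover have "q.S.independent ?K (map (q \<circ> b) xs)"
      by (rule Cons.IH) (use Cons.prems in simp_all)
    moreover have "q (b u) \<in> carrier R"
      by simp
    ultimately have "q.S.independent ?K (q (b u) # map (q \<circ> b) xs)"
      by (intro q.S.independent.li_Cons)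
    then show ?case by (simp add: comp_def)
  qed (simp add: q.S.independent.li_Nil)
  obtain xs where xs: "set xs = A" "distinct xs"
    using finite_distinct_list [OF fin] by blast
  have "q.S.dimension (length (map (q \<circ> b) xs)) ?K V"
    using q.S.dimension_independent [OF independent [of xs]] xs
    unfolding V span [OF xs(2)] by blast
  then show ?thesis
    using q.S.dimI [OF K] distinct_card [OF xs(2)] xs(1) by simp
qed

lemma forms_eq_range:
  "(forms d :: ('n::finite, 'k::comm_semiring_1) mpoly set) =
     range (\<lambda>c. \<Sum>\<alpha>\<in>{\<alpha>. mdeg \<alpha> = d}. Const (c \<alpha>) * Poly_Mapping.single \<alpha> 1)"
proof -
  have "(\<Sum>\<alpha>\<in>{\<alpha>. mdeg \<alpha> = d}. Const (c \<alpha>) * Poly_Mapping.single \<alpha> 1) \<in> forms d"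
    for c :: "('n \<Rightarrow>\<^sub>0 nat) \<Rightarrow> 'k"
    by (intro forms_sum forms_Const_mult) simp
  then show ?thesis
    using form_expand by blast
qed

lemma lookup_sum_Const_single:
  fixes c :: "('n::finite \<Rightarrow>\<^sub>0 nat) \<Rightarrow> 'k::comm_semiring_1"
  assumes "mdeg \<alpha> = d"
  shows "Poly_Mapping.lookup (\<Sum>\<alpha>\<in>{\<alpha>. mdeg \<alpha> = d}. Const (c \<alpha>) * Poly_Mapping.single \<alpha> 1) \<alpha> = c \<alpha>"
  using assms by (simp add: Const_mult_single lookup_sum lookup_single when_def finite_mdeg)

lemma dim_forms_eq:
  "dim_forms TYPE('n::finite) TYPE('k::field) d = card {\<alpha> :: 'n \<Rightarrow>\<^sub>0 nat. mdeg \<alpha> = d}"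
proof -
  interpret R: cring "mpoly_ring :: ('n, 'k) mpoly ring" by (rule cring_mpoly_ring)
  have "ring_hom_ring (mpoly_ring :: ('n, 'k) mpoly ring) mpoly_ring id"
    by (intro ring_hom_ringI R.ring_axioms) simp_all
  then have "(ring.dim (mpoly_ring :: ('n, 'k) mpoly ring) over (id ` range Const)) (forms d) =
      card {\<alpha> :: 'n \<Rightarrow>\<^sub>0 nat. mdeg \<alpha> = d}"
  proof (rule dim_eq_cardI [where b = "\<lambda>\<alpha>. Poly_Mapping.single \<alpha> 1"])
    fix c :: "('n \<Rightarrow>\<^sub>0 nat) \<Rightarrow> 'k"
    assume "id (\<Sum>\<alpha>\<in>{\<alpha>. mdeg \<alpha> = d}. Const (c \<alpha>) * Poly_Mapping.single \<alpha> 1) = \<zero>\<^bsub>mpoly_ring\<^esub>"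
    then show "\<forall>\<alpha>\<in>{\<alpha>. mdeg \<alpha> = d}. c \<alpha> = 0"
      using lookup_sum_Const_single [of _ d c] by simp
  qed (simp_all add: finite_mdeg forms_eq_range)
  then show ?thesis by (simp add: dim_forms_def)
qed

section \<open>Compressedness\<close>

text \<open>Raising the exponent of one variable by \<open>t - s\<close> is injective;
  \<open>undefined\<close> stands for an arbitrary variable.\<close>

lemma card_mdeg_mono:
  assumes "s \<le> t"
  shows "card {\<alpha> :: 'n::finite \<Rightarrow>\<^sub>0 nat. mdeg \<alpha> = s} \<le> card {\<alpha> :: 'n \<Rightarrow>\<^sub>0 nat. mdeg \<alpha> = t}"
proof (rule card_inj_on_le [where f = "\<lambda>\<alpha>. \<alpha> + Poly_Mapping.single undefined (t - s)"])
  show "(\<lambda>\<alpha>. \<alpha> + Poly_Mapping.single undefined (t - s)) ` {\<alpha> :: 'n \<Rightarrow>\<^sub>0 nat. mdeg \<alpha> = s} \<subseteq> {\<alpha>. mdeg \<alpha> = t}"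
    using assms by (auto simp: mdeg_add)
qed (simp_all add: inj_on_def finite_mdeg)

text \<open>Makes the quotient nontrivial, so that the image of the constants is a field.\<close>

lemma one_notin_ann_complete_symmetric:
  "(1 :: ('n::finite, 'k::comm_ring_1) mpoly) \<notin> ann (complete_symmetric e)"
proof
  assume "(1 :: ('n, 'k) mpoly) \<in> ann (complete_symmetric e)"
  then have "(complete_symmetric e :: ('n, 'k) mpoly) = 0"
    using diff_act_Const [of 1 "complete_symmetric e :: ('n, 'k) mpoly"] by (simp add: ann_def Const_def)
  then show False
    using lookup_complete_symmetric [of e "Poly_Mapping.single (undefined :: 'n) e", where 'a = 'k]
    by simp
qed

text \<open>With \<open>s = min i (e - i)\<close>, the monomials of degree \<open>s\<close> times
  \<ell> to the power \<open>i - s\<close> give a basis, \<ell> being the sum of the variables.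
  Independence is Lefschetz injectivity, as \<open>2 * s + (i - s) \<le> e\<close>; spanning is
  immediate for \<open>i = s\<close> and Lefschetz surjectivity otherwise.\<close>

lemma dim_quot_comp_complete_symmetric:
  assumes "i \<le> e"
  shows "dim_quot_comp (ann (complete_symmetric e :: ('n::finite, 'k::field_char_0) mpoly)) i =
     card {\<alpha> :: 'n \<Rightarrow>\<^sub>0 nat. mdeg \<alpha> = min i (e - i)}"
proof -
  define s where "s = min i (e - i)"
  let ?I = "ann (complete_symmetric e :: ('n, 'k) mpoly)"
  let ?l = "linear_form (\<lambda>_. 1) :: ('n, 'k) mpoly"
  let ?A = "{\<alpha> :: 'n \<Rightarrow>\<^sub>0 nat. mdeg \<alpha> = s}"
  let ?g = "\<lambda>c. \<Sum>\<alpha>\<in>?A. Const (c \<alpha>) * Poly_Mapping.single \<alpha> (1 :: 'k)"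
  interpret h: ring_hom_ring mpoly_ring "mpoly_ring Quot ?I" "quot_class ?I"
    by (rule ideal.rcos_ring_hom_ring [OF ideal_ann])
  have zero: "quot_class ?I g = \<zero>\<^bsub>mpoly_ring Quot ?I\<^esub> \<longleftrightarrow> g \<in> ?I" for g
    using quot_class_eq_iff [of "complete_symmetric e" g 0] h.hom_zero by simp
  have sum: "(\<Sum>\<alpha>\<in>?A. Const (c \<alpha>) * (?l ^ (i - s) * Poly_Mapping.single \<alpha> 1)) = ?l ^ (i - s) * ?g c" for c
    by (simp only: sum_distrib_left mult.left_commute)
  have g: "?g c \<in> forms s" for c
    by (intro forms_sum forms_Const_mult) simp
  have det: "eval_mpoly (\<lambda>_. 1) (lefschetz_det e s :: ('n, 'k) mpoly) \<noteq> 0"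
    by (rule eval_lefschetz_det_sum_vars)
  have "(ring.dim (mpoly_ring Quot ?I) over (quot_class ?I ` range Const)) (quot_comp ?I i) = card ?A"
  proof (rule dim_eq_cardI [where b = "\<lambda>\<alpha>. ?l ^ (i - s) * Poly_Mapping.single \<alpha> 1"])
    show "ring_hom_ring mpoly_ring (mpoly_ring Quot ?I) (quot_class ?I)"
      by (rule h.ring_hom_ring_axioms)
    show "\<one>\<^bsub>mpoly_ring Quot ?I\<^esub> \<noteq> \<zero>\<^bsub>mpoly_ring Quot ?I\<^esub>"
      using zero [of 1] h.hom_one one_notin_ann_complete_symmetric by auto
    show "finite ?A" by (rule finite_mdeg)
    fix c :: "('n \<Rightarrow>\<^sub>0 nat) \<Rightarrow> 'k"
    assume "quot_class ?I (\<Sum>\<alpha>\<in>?A. Const (c \<alpha>) * (?l ^ (i - s) * Poly_Mapping.single \<alpha> 1)) =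
        \<zero>\<^bsub>mpoly_ring Quot ?I\<^esub>"
    then have "?l ^ (i - s) * ?g c \<in> ?I"
      unfolding sum zero .
    then have "?g c = 0"
      using assms by (intro lefschetz_injective [OF det _ g]) (auto simp: s_def)
    then show "\<forall>\<alpha>\<in>?A. c \<alpha> = 0"
      using lookup_sum_Const_single [of _ s c] by simp
  next
    have "\<exists>c. quot_class ?I f = quot_class ?I (?l ^ (i - s) * ?g c)" if f: "f \<in> forms i" for f
    proof (cases "i = s")
      case True
      then show ?thesis
        using f form_expand [of f i] by (auto intro!: exI [of _ "Poly_Mapping.lookup f"])
    next
      case False
      then have s: "2 * s \<le> e" "i = e - s" "i - s = e - 2 * s"
        using assms by (auto simp: s_def)
      obtain g where "g \<in> forms s" "f - ?l ^ (e - 2 * s) * g \<in> ?I"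
        using lefschetz_surjective [OF det s(1)] f s(2) by metis
      then show ?thesis
        unfolding quot_class_eq_iff s(3)
        using form_expand [of g s] by (auto intro!: exI [of _ "Poly_Mapping.lookup g"])
    qed
    moreover have "?l ^ (i - s) * ?g c \<in> forms i" for c
      using linear_form_power_mult_in_forms [OF g, of "\<lambda>_. 1" "i - s" c] by (simp add: s_def)
    ultimately show "quot_comp ?I i = range (\<lambda>c. quot_class ?I
        (\<Sum>\<alpha>\<in>?A. Const (c \<alpha>) * (?l ^ (i - s) * Poly_Mapping.single \<alpha> 1)))"
      unfolding sum quot_comp_def by (auto simp: image_iff)
  qed
  then show ?thesis by (simp add: dim_quot_comp_def s_def)
qed

lemma compressed_complete_symmetric:
  "compressed e (ann (complete_symmetric e :: ('n::finite, 'k::field_char_0) mpoly))"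
  unfolding compressed_def
proof (intro allI impI)
  fix i assume "i \<le> e"
  show "dim_quot_comp (ann (complete_symmetric e :: ('n, 'k) mpoly)) i =
      min (dim_forms TYPE('n) TYPE('k) i) (dim_forms TYPE('n) TYPE('k) (e - i))"
    unfolding dim_quot_comp_complete_symmetric [OF \<open>i \<le> e\<close>] dim_forms_eq
    using card_mdeg_mono [of i "e - i", where 'n = 'n] card_mdeg_mono [of "e - i" i, where 'n = 'n]
    by (cases "i \<le> e - i") (simp_all add: min_def)
qed

section \<open>The strong Lefschetz property\<close>

text \<open>The map is injective if \<open>2 * i + j \<le> e\<close>, that is, if the source degree
  is at most the degree \<open>e - (i + j)\<close> dual to the target. Otherwise it is
  surjective.\<close>

lemma maximal_rank_complete_symmetric:
  fixes a :: "'n::finite \<Rightarrow> 'k::field_char_0"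
  assumes det: "\<And>s. 2 * s \<le> e \<Longrightarrow> eval_mpoly a (lefschetz_det e s) \<noteq> 0"
  defines "I \<equiv> ann (complete_symmetric e :: ('n, 'k) mpoly)"
  shows "inj_on (mult_map I (linear_form a) j) (quot_comp I i) \<or>
     mult_map I (linear_form a) j ` quot_comp I i = quot_comp I (i + j)"
proof (cases "2 * i + j \<le> e")
  case True
  have "inj_on (mult_map I (linear_form a) j) (quot_comp I i)"
  proof (rule inj_onI)
    fix x y assume "x \<in> quot_comp I i" "y \<in> quot_comp I i"
      and eq: "mult_map I (linear_form a) j x = mult_map I (linear_form a) j y"
    then obtain g h where gh: "g \<in> forms i" "h \<in> forms i" "x = quot_class I g" "y = quot_class I h"
      by (auto simp: quot_comp_def)
    have "linear_form a ^ j * (g - h) \<in> I"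
      using eq unfolding gh I_def mult_map_quot_class quot_class_eq_iff
      by (simp add: right_diff_distrib)
    then have "g - h = 0"
      using True unfolding I_def
      by (intro lefschetz_injective [OF det True forms_diff [OF gh(1,2)]]) auto
    then show "x = y" by (simp add: gh)
  qed
  then show ?thesis ..
next
  case False
  have "\<exists>g\<in>forms i. f - linear_form a ^ j * g \<in> I" if f: "f \<in> forms (i + j)" for f
  proof (cases "i + j \<le> e")
    case True
    \<comment> \<open>The degree dual to the target, here below \<open>i\<close>. The surjection
      from degree \<open>s\<close> factors through degree \<open>i\<close> with last factor \<ell>
      to the power \<open>j\<close>.\<close>
    define s where "s = e - (i + j)"
    have s: "2 * s \<le> e" "e - s = i + j" "e - 2 * s = j + (i - s)" "i - s + s = i"
      using True False by (auto simp: s_def)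
    obtain g where g: "g \<in> forms s" "f - linear_form a ^ (e - 2 * s) * g \<in> I"
      using lefschetz_surjective [OF det [OF s(1)] s(1), of f] f unfolding s(2) I_def by blast
    have "linear_form a ^ (i - s) * g \<in> forms i"
      using linear_form_power_mult_in_forms [OF g(1), of a "i - s"] by (simp only: s(4))
    moreover have "f - linear_form a ^ j * (linear_form a ^ (i - s) * g) \<in> I"
      using g(2) unfolding s(3) by (simp add: power_add mult.assoc)
    ultimately show ?thesis by blast
  next
    case False
    \<comment> \<open>Above the socle degree the target is zero, so 0 is a preimage.\<close>
    then have "f \<in> I"
      using in_ann_complete_symmetric_iff [OF f, of e] by (simp add: I_def)
    then show ?thesis by (intro bexI [of _ 0]) simp_all
  qed
  then have "quot_comp I (i + j) \<subseteq> mult_map I (linear_form a) j ` quot_comp I i"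
    unfolding quot_comp_def I_def image_image mult_map_quot_class
    by (auto simp: image_iff quot_class_eq_iff)
  moreover have "mult_map I (linear_form a) j ` quot_comp I i \<subseteq> quot_comp I (i + j)"
    unfolding quot_comp_def I_def image_image mult_map_quot_class
    using linear_form_power_mult_in_forms [of _ i a j] by (auto simp: add.commute)
  ultimately show ?thesis by blast
qed

text \<open>Only finitely many \<open>s\<close> satisfy \<open>2 * s \<le> e\<close>, so the product
  of their determinants cuts out one open set that works for all \<open>i\<close> and
  \<open>j\<close>. The all-ones vector shows that it is nonempty.\<close>

lemma strong_lefschetz_complete_symmetric:
  "strong_lefschetz (ann (complete_symmetric e :: ('n::finite, 'k::field_char_0) mpoly))"
proof -
  let ?P = "\<Prod>s\<in>{s. 2 * s \<le> e}. lefschetz_det e s :: ('n, 'k) mpoly"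
  let ?U = "{a. eval_mpoly a ?P \<noteq> 0}"
  have fin: "finite {s. 2 * s \<le> e}"
    by (rule finite_subset [of _ "{..e}"]) auto
  have eval: "eval_mpoly a ?P = (\<Prod>s\<in>{s. 2 * s \<le> e}. eval_mpoly a (lefschetz_det e s))" for a
  proof -
    interpret comm_ring_hom "eval_mpoly a" by (rule comm_ring_hom_eval_mpoly)
    show ?thesis by (rule hom_prod)
  qed
  have "zariski_open ?U"
    unfolding zariski_open_def by (intro exI [of _ "{?P}"]) simp
  moreover have "(\<lambda>_. 1) \<in> ?U"
    by (simp add: eval fin eval_lefschetz_det_sum_vars)
  moreover have "inj_on (mult_map (ann (complete_symmetric e)) (linear_form a) j)
        (quot_comp (ann (complete_symmetric e)) i) \<or>
      mult_map (ann (complete_symmetric e)) (linear_form a) j ` quot_comp (ann (complete_symmetric e)) i =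
        quot_comp (ann (complete_symmetric e)) (i + j)" if "a \<in> ?U" for a i j
    using that by (intro maximal_rank_complete_symmetric) (auto simp: eval fin)
  ultimately show ?thesis
    unfolding strong_lefschetz_def by blast
qed

theorem theorem2p11:
  fixes e :: nat
  shows "compressed e (ann (complete_symmetric e :: ('n::finite, 'k::field_char_0) mpoly)) \<and>
         strong_lefschetz (ann (complete_symmetric e :: ('n, 'k) mpoly))"
  using compressed_complete_symmetric strong_lefschetz_complete_symmetric by blast

end
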